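(* There exists a universal constant $M_0>0$ such that the following holds. Let $d\geq 2$, $s\in(0,1)$, $p\in(1,\infty)$ with $sp\neq 1$. For any epigraph $D\subset\mathbb{R}^d$ supported by a function $f$ whose Lipschitz constant satisfies $M<M_0$, there exists a bounded extension operator $$\mathrm{E} : [C^1_c(D)]^d \to [C^1_c(\mathbb{R}^d)]^d$$ with the property that for every $\mathbf{u}\in[C^1_c(D)]^d$, $$\|\mathrm{E}(\mathbf{u})\|_{\mathcal{X}^{s,p}(\mathbb{R}^d)} \leq C\left( \|\mathbf{u}\|_{\mathcal{X}^{s,p}(D)} + M\,\|\mathbf{u}\|_{W^{s,p}(D)} \right),$$ where the constant $C$ depends only on $M_0$, $d$, $s$, and $p$ (in particular not on $M$).
   Context: Write points of $\mathbb{R}^d$ as $\mathbf{x}=(\mathbf{x}',x_d)$ with $\mathbf{x}'\in\mathbb{R}^{d-1}$. Let $f:\mathbb{R}^{d-1}\to\mathbb{R}$ be a $C^1$ globally Lipschitz function with $f(0)=0$ and $\nabla f(0)=0$. The epigraph supported by $f$ is $D=\{(\mathbf{x}',x_d)\in\mathbb{R}^d : x_d>f(\mathbf{x}')\}$, and its Lipschitz constant is $M:=\|\nabla f\|_{L^\infty(\mathbb{R}^{d-1})}$. For an open set $U\subseteq\mathbb{R}^d$ and $\mathbf{u}:U\to\mathbb{R}^d$, $$[\mathbf{u}]_{\mathcal{X}^{s,p}(U)}^p := \int_U\int_U \frac{\left| (\mathbf{u}(\mathbf{x})-\mathbf{u}(\mathbf{y}))\cdot\frac{\mathbf{x}-\mathbf{y}}{|\mathbf{x}-\mathbf{y}|}\right|^p}{|\mathbf{x}-\mathbf{y}|^{d+sp}}\,d\mathbf{y}\,d\mathbf{x},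 \qquad |\mathbf{u}|_{W^{s,p}(U)}^p := \int_U\int_U \frac{|\mathbf{u}(\mathbf{x})-\mathbf{u}(\mathbf{y})|^p}{|\mathbf{x}-\mathbf{y}|^{d+sp}}\,d\mathbf{y}\,d\mathbf{x},$$ $\|\mathbf{u}\|_{\mathcal{X}^{s,p}(U)} := [\mathbf{u}]_{\mathcal{X}^{s,p}(U)}+\|\mathbf{u}\|_{L^p(U)}$ and $\|\mathbf{u}\|_{W^{s,p}(U)} := |\mathbf{u}|_{W^{s,p}(U)}+\|\mathbf{u}\|_{L^p(U)}$. $[C^1_c(U)]^d$ denotes the set of continuously differentiable vector fields on $U$ whose support is compactly contained in $U$. An extension operator is a linear map $\mathrm{E}$ with $\mathrm{E}(\mathbf{u})=\mathbf{u}$ on $D$; "bounded" is meant in the sense of the displayed estimate. *)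

theory Defs
  imports "HOL-Probability.Probability"
begin

text \<open>
  The constant \<open>M\<^sub>0\<close> is chosen before the dimension \<open>d\<close>, so \<open>d\<close> has to be a term
  variable. Points of \<open>R\<^sup>d\<close> are therefore functions \<open>x :: nat \<Rightarrow> real\<close> that are extensional
  on \<open>{..<d}\<close>; the last coordinate \<open>x\<^sub>d\<close> is \<open>x (d - 1)\<close>, and \<open>x'\<close> is the restriction of \<open>x\<close>
  to \<open>{..<d - 1}\<close>. This carrier is the underlying set both of the product topology and of the
  product of the one-dimensional Lebesgue measures.
\<close>

definition Rn :: "nat \<Rightarrow> (nat \<Rightarrow> real) set" where
  "Rn d = ({..<d} \<rightarrow>\<^sub>E UNIV)"

definition Rn_top :: "nat \<Rightarrow> (nat \<Rightarrow> real) topology" where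
  "Rn_top d = product_topology (\<lambda>_. euclideanreal) {..<d}"

definition Rn_lborel :: "nat \<Rightarrow> (nat \<Rightarrow> real) measure" where
  "Rn_lborel d = Pi\<^sub>M {..<d} (\<lambda>_. lborel)"

lemma topspace_Rn_top: "topspace (Rn_top d) = Rn d"
  by (simp add: Rn_top_def Rn_def)

lemma space_Rn_lborel: "space (Rn_lborel d) = Rn d"
  by (simp add: Rn_lborel_def Rn_def space_PiM)

definition Rn_zero :: "nat \<Rightarrow> nat \<Rightarrow> real" where
  "Rn_zero d = (\<lambda>i\<in>{..<d}. 0)"

definition Rn_norm :: "nat \<Rightarrow> (nat \<Rightarrow> real) \<Rightarrow> real" where
  "Rn_norm d x = L2_set x {..<d}"

definition Rn_minus :: "nat \<Rightarrow> (nat \<Rightarrow> real) \<Rightarrow> (nat \<Rightarrow> real) \<Rightarrow> nat \<Rightarrow> real" where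
  "Rn_minus d x y = (\<lambda>i\<in>{..<d}. x i - y i)"

definition Rn_dist :: "nat \<Rightarrow> (nat \<Rightarrow> real) \<Rightarrow> (nat \<Rightarrow> real) \<Rightarrow> real" where
  "Rn_dist d x y = Rn_norm d (Rn_minus d x y)"

definition Rn_inner :: "nat \<Rightarrow> (nat \<Rightarrow> real) \<Rightarrow> (nat \<Rightarrow> real) \<Rightarrow> real" where
  "Rn_inner d x y = (\<Sum>i<d. x i * y i)"


definition partial_deriv :: "nat \<Rightarrow> ((nat \<Rightarrow> real) \<Rightarrow> real) \<Rightarrow> (nat \<Rightarrow> real) \<Rightarrow> real" where
  "partial_deriv i g x = deriv (\<lambda>t. g (x(i := t))) (x i)"

text \<open>
  Meant for open \<open>U\<close>, where \<open>x(i := t)\<close> stays in \<open>U\<close> for \<open>t\<close> near \<open>x i\<close>; the values of \<open>g\<close>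
  off \<open>U\<close> are then irrelevant.
\<close>

definition C1_on :: "nat \<Rightarrow> (nat \<Rightarrow> real) set \<Rightarrow> ((nat \<Rightarrow> real) \<Rightarrow> real) \<Rightarrow> bool" where
  "C1_on d U g \<longleftrightarrow>
     (\<forall>i<d. (\<forall>x\<in>U. (\<lambda>t. g (x(i := t))) differentiable (at (x i))) \<and>
            continuous_map (subtopology (Rn_top d) U) euclideanreal (partial_deriv i g))"

definition gradient :: "nat \<Rightarrow> ((nat \<Rightarrow> real) \<Rightarrow> real) \<Rightarrow> (nat \<Rightarrow> real) \<Rightarrow> nat \<Rightarrow> real" where
  "gradient d g x = (\<lambda>i\<in>{..<d}. partial_deriv i g x)"

definition field_support :: "nat \<Rightarrow> (nat \<Rightarrow> real) set \<Rightarrow> ((nat \<Rightarrow> real) \<Rightarrow> (nat \<Rightarrow> real)) \<Rightarrow> (nat \<Rightarrow> real) set" where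
  "field_support d U u = Rn_top d closure_of {x \<in> U. u x \<noteq> Rn_zero d}"

text \<open>
  Vector fields on \<open>U\<close> are extensional on \<open>U\<close>, so that two of them are equal as soon as they
  agree on \<open>U\<close>. The support is closed in the whole space, hence \<open>field_support d U u \<subseteq> U\<close>
  keeps it away from the boundary of \<open>U\<close>.
\<close>

definition C1c_fields :: "nat \<Rightarrow> (nat \<Rightarrow> real) set \<Rightarrow> ((nat \<Rightarrow> real) \<Rightarrow> (nat \<Rightarrow> real)) set" where
  "C1c_fields d U =
     {u \<in> U \<rightarrow>\<^sub>E Rn d. (\<forall>j<d. C1_on d U (\<lambda>x. u x j)) \<and>
        compactin (Rn_top d) (field_support d U u) \<and> field_support d U u \<subseteq> U}"

definition field_lincomb ::
  "nat \<Rightarrow> (nat \<Rightarrow> real) set \<Rightarrow> real \<Rightarrow> ((nat \<Rightarrow> real) \<Rightarrow> (nat \<Rightarrow> real)) \<Rightarrow> real \<Rightarrow> ((nat \<Rightarrow> real) \<Rightarrow> (nat \<Rightarrow> real))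
     \<Rightarrow> (nat \<Rightarrow> real) \<Rightarrow> (nat \<Rightarrow> real)" where
  "field_lincomb d U a u b v = (\<lambda>x\<in>U. \<lambda>i\<in>{..<d}. a * u x i + b * v x i)"


definition supporting_function :: "nat \<Rightarrow> ((nat \<Rightarrow> real) \<Rightarrow> real) \<Rightarrow> bool" where
  "supporting_function d f \<longleftrightarrow>
     C1_on (d - 1) (Rn (d - 1)) f \<and>
     (\<exists>L. \<forall>x\<in>Rn (d - 1). \<forall>y\<in>Rn (d - 1). \<bar>f x - f y\<bar> \<le> L * Rn_dist (d - 1) x y) \<and>
     f (Rn_zero (d - 1)) = 0 \<and>
     gradient (d - 1) f (Rn_zero (d - 1)) = Rn_zero (d - 1)"

definition epigraph_domain :: "nat \<Rightarrow> ((nat \<Rightarrow> real) \<Rightarrow> real) \<Rightarrow> (nat \<Rightarrow> real) set" where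
  "epigraph_domain d f = {x \<in> Rn d. x (d - 1) > f (restrict x {..<d - 1})}"

definition epigraph_lipschitz_const :: "nat \<Rightarrow> ((nat \<Rightarrow> real) \<Rightarrow> real) \<Rightarrow> ennreal" where
  "epigraph_lipschitz_const d f =
     esssup (Rn_lborel (d - 1)) (\<lambda>x. ennreal (Rn_norm (d - 1) (gradient (d - 1) f x)))"


definition ennreal_root :: "real \<Rightarrow> ennreal \<Rightarrow> ennreal" where
  "ennreal_root p a = (if a = \<top> then \<top> else ennreal (enn2real a powr (1 / p)))"

text \<open>
  On the diagonal \<open>x = y\<close>, a null set, both integrands below are \<open>0\<close> by the convention
  \<open>a / 0 = 0\<close>.
\<close>

definition X_seminorm ::
  "nat \<Rightarrow> real \<Rightarrow> real \<Rightarrow> (nat \<Rightarrow> real) set \<Rightarrow> ((nat \<Rightarrow> real) \<Rightarrow> (nat \<Rightarrow> real)) \<Rightarrow> ennreal" where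
  "X_seminorm d s p U u = ennreal_root p
     (\<integral>\<^sup>+x\<in>U. (\<integral>\<^sup>+y\<in>U. ennreal
        (\<bar>Rn_inner d (Rn_minus d (u x) (u y)) (\<lambda>i\<in>{..<d}. (x i - y i) / Rn_dist d x y)\<bar> powr p
          / Rn_dist d x y powr (real d + s * p)) \<partial>Rn_lborel d) \<partial>Rn_lborel d)"

definition W_seminorm ::
  "nat \<Rightarrow> real \<Rightarrow> real \<Rightarrow> (nat \<Rightarrow> real) set \<Rightarrow> ((nat \<Rightarrow> real) \<Rightarrow> (nat \<Rightarrow> real)) \<Rightarrow> ennreal" where
  "W_seminorm d s p U u = ennreal_root p
     (\<integral>\<^sup>+x\<in>U. (\<integral>\<^sup>+y\<in>U. ennreal
        (Rn_dist d (u x) (u y) powr p / Rn_dist d x y powr (real d + s * p))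
        \<partial>Rn_lborel d) \<partial>Rn_lborel d)"

definition Lp_norm ::
  "nat \<Rightarrow> real \<Rightarrow> (nat \<Rightarrow> real) set \<Rightarrow> ((nat \<Rightarrow> real) \<Rightarrow> (nat \<Rightarrow> real)) \<Rightarrow> ennreal" where
  "Lp_norm d p U u = ennreal_root p (\<integral>\<^sup>+x\<in>U. ennreal (Rn_norm d (u x) powr p) \<partial>Rn_lborel d)"

definition X_norm ::
  "nat \<Rightarrow> real \<Rightarrow> real \<Rightarrow> (nat \<Rightarrow> real) set \<Rightarrow> ((nat \<Rightarrow> real) \<Rightarrow> (nat \<Rightarrow> real)) \<Rightarrow> ennreal" where
  "X_norm d s p U u = X_seminorm d s p U u + Lp_norm d p U u"

definition W_norm ::
  "nat \<Rightarrow> real \<Rightarrow> real \<Rightarrow> (nat \<Rightarrow> real) set \<Rightarrow> ((nat \<Rightarrow> real) \<Rightarrow> (nat \<Rightarrow> real)) \<Rightarrow> ennreal" where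
  "W_norm d s p U u = W_seminorm d s p U u + Lp_norm d p U u"


definition extension_operator ::
  "nat \<Rightarrow> (nat \<Rightarrow> real) set \<Rightarrow> (((nat \<Rightarrow> real) \<Rightarrow> (nat \<Rightarrow> real)) \<Rightarrow> ((nat \<Rightarrow> real) \<Rightarrow> (nat \<Rightarrow> real))) \<Rightarrow> bool" where
  "extension_operator d D E \<longleftrightarrow>
     E \<in> C1c_fields d D \<rightarrow> C1c_fields d (Rn d) \<and>
     (\<forall>u\<in>C1c_fields d D. \<forall>v\<in>C1c_fields d D. \<forall>a b.
        E (field_lincomb d D a u b v) = field_lincomb d (Rn d) a (E u) b (E v)) \<and>
     (\<forall>u\<in>C1c_fields d D. \<forall>x\<in>D. E u x = u x)"

end

theory Submission
  imports Defs
begin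

text \<open>
  The extension is by zero. Its energy exceeds that of \<open>u\<close> on \<open>D\<close> by the interaction between
  \<open>D\<close> and its complement, which is at most a constant times
  \<open>\<integral>\<^sub>D \<bar>u\<bar>\<^sup>p / \<rho>\<^sup>s\<^sup>p\<close> with \<open>\<rho> x = x\<^sub>d - f x'\<close>, so everything reduces to a Hardy
  inequality for the projected seminorm. For a direction \<open>(a, 1)\<close> with small \<open>a\<close>, every line in
  this direction meets \<open>D\<close> in a half-line on which \<open>\<rho>\<close> is comparable to the distance to the end point,
  and the one-dimensional fractional Hardy inequality (which needs \<open>s p \<noteq> 1\<close>) applies to the
  component of \<open>u\<close> in that direction. This component is exactly what the projected difference
  quotient sees on the line. Integrating over the lines and over \<open>a\<close>
  recovers the double integral over \<open>D\<close>, and the components along all \<open>(a, 1)\<close> control \<open>u\<close>.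
\<close>

section \<open>Topology and partial derivatives on coordinate space\<close>

text \<open>The obstacle is that the projected difference of two points on a vertical line sees only
  the last component of \<open>u\<close>, so a Hardy inequality in the vertical direction alone
  cannot bound the whole field. A full cube of directions \<open>(a, 1)\<close> is therefore used,
  and \<open>a\<close> plays two roles: averaging over it recovers every component, and for two
  fixed heights it is the integration variable that moves the second point. The value 1 for
  \<open>M0\<close> comes from measuring slopes in the l1 sense. A gradient of length below 1 almost
  everywhere has, by continuity, all partial derivatives bounded by 1 everywhere, so
  \<open>f\<close> varies by at most the l1 distance. A direction with l1 norm of \<open>a\<close>
  at most 1/2 then changes \<open>f\<close> at rate at most 1/2 while the last coordinate moves at
  rate 1. The dimension enters only through the side of the cube of directions and through the final
  constant. Compact support inside \<open>D\<close> serves twice: it makes the extension by zero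
  continuously differentiable, and it makes the weighted norm finite, so that a fraction of it can
  be subtracted from both sides. The size and position of the support enter no constant.\<close>

lemma openin_Rn_top_iff:
  "openin (Rn_top d) V \<longleftrightarrow> V \<subseteq> Rn d \<and>
     (\<forall>x\<in>V. \<exists>e>0. \<forall>y\<in>Rn d. (\<forall>i<d. \<bar>y i - x i\<bar> < e) \<longrightarrow> y \<in> V)"
proof (intro iffI conjI ballI)
  assume V: "openin (Rn_top d) V"
  show "V \<subseteq> Rn d" using openin_subset[OF V] by (simp add: topspace_Rn_top)
  fix x assume x: "x \<in> V"
  then have "\<exists>U. finite {i \<in> {..<d}. U i \<noteq> topspace euclideanreal} \<and>
      (\<forall>i\<in>{..<d}. openin euclideanreal (U i)) \<and> x \<in> Pi\<^sub>E {..<d} U \<and> Pi\<^sub>E {..<d} U \<subseteq> V"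
    using V unfolding Rn_top_def openin_product_topology_alt by blast
  then obtain U where U: "\<And>i. i < d \<Longrightarrow> open (U i)" "x \<in> Pi\<^sub>E {..<d} U" "Pi\<^sub>E {..<d} U \<subseteq> V"
    by auto
  have "\<exists>e>0. \<forall>t. \<bar>t - x i\<bar> < e \<longrightarrow> t \<in> U i" if "i < d" for i
    using U(1)[OF that] U(2) that unfolding open_dist dist_real_def PiE_def Pi_def by auto
  then obtain e where e: "\<And>i. i < d \<Longrightarrow> e i > 0" "\<And>i t. i < d \<Longrightarrow> \<bar>t - x i\<bar> < e i \<Longrightarrow> t \<in> U i"
    by metis
  \<comment> \<open>The extra element 1 keeps the set nonempty when \<open>d = 0\<close>.\<close>
  define e0 where "e0 = Min (insert 1 (e ` {..<d}))"
  have "e0 > 0" unfolding e0_def using e(1) by (subst Min_gr_iff) auto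
  have "e0 \<le> e i" if "i < d" for i unfolding e0_def using that by (intro Min_le) auto
  then have "\<forall>y\<in>Rn d. (\<forall>i<d. \<bar>y i - x i\<bar> < e0) \<longrightarrow> y \<in> V"
  proof (intro ballI impI)
    fix y assume y: "y \<in> Rn d" "\<forall>i<d. \<bar>y i - x i\<bar> < e0"
    have "y \<in> Pi\<^sub>E {..<d} U" if "\<And>i. i < d \<Longrightarrow> e0 \<le> e i"
      using y e(2) that unfolding Rn_def PiE_iff by fastforce
    then show "y \<in> V" using U(3) \<open>\<And>i. i < d \<Longrightarrow> e0 \<le> e i\<close> by blast
  qed
  with \<open>e0 > 0\<close> show "\<exists>e>0. \<forall>y\<in>Rn d. (\<forall>i<d. \<bar>y i - x i\<bar> < e) \<longrightarrow> y \<in> V" by blast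
next
  assume A: "V \<subseteq> Rn d \<and>
     (\<forall>x\<in>V. \<exists>e>0. \<forall>y\<in>Rn d. (\<forall>i<d. \<bar>y i - x i\<bar> < e) \<longrightarrow> y \<in> V)"
  show "openin (Rn_top d) V"
    unfolding Rn_top_def openin_product_topology_alt
  proof
    fix x assume x: "x \<in> V"
    then obtain e where e: "e > 0" "\<And>y. y \<in> Rn d \<Longrightarrow> (\<forall>i<d. \<bar>y i - x i\<bar> < e) \<Longrightarrow> y \<in> V"
      using A by blast
    have "x \<in> Rn d" using A x by auto
    then show "\<exists>U. finite {i \<in> {..<d}. U i \<noteq> topspace euclideanreal} \<and>
         (\<forall>i\<in>{..<d}. openin euclideanreal (U i)) \<and> x \<in> Pi\<^sub>E {..<d} U \<and> Pi\<^sub>E {..<d} U \<subseteq> V"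
      using e by (intro exI[of _ "\<lambda>i. ball (x i) e"])
        (auto simp: Rn_def PiE_iff dist_real_def abs_minus_commute)
  qed
qed

lemma continuous_map_Rn_iff:
  assumes U: "openin (Rn_top d) U"
  shows "continuous_map (subtopology (Rn_top d) U) euclideanreal g \<longleftrightarrow>
    (\<forall>x\<in>U. \<forall>e>0. \<exists>r>0. \<forall>y\<in>U. (\<forall>i<d. \<bar>y i - x i\<bar> < r) \<longrightarrow> \<bar>g y - g x\<bar> < e)"
proof -
  have sub: "U \<subseteq> Rn d" using U by (simp add: openin_Rn_top_iff)
  have "continuous_map (subtopology (Rn_top d) U) euclideanreal g \<longleftrightarrow>
     (\<forall>x\<in>U. \<forall>e>0. \<exists>V. openin (subtopology (Rn_top d) U) V \<and> x \<in> V \<and> (\<forall>y\<in>V. \<bar>g y - g x\<bar> < e))"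
    (is "?L = ?R")
  proof -
    have "continuous_map (subtopology (Rn_top d) U) Met_TC.mtopology g \<longleftrightarrow> ?R"
      unfolding Met_TC.continuous_map_to_metric
      using sub by (auto simp: topspace_Rn_top Int_absorb1 dist_real_def abs_minus_commute)
    then show ?thesis by simp
  qed
  also have "\<dots> \<longleftrightarrow> (\<forall>x\<in>U. \<forall>e>0. \<exists>r>0. \<forall>y\<in>U. (\<forall>i<d. \<bar>y i - x i\<bar> < r) \<longrightarrow> \<bar>g y - g x\<bar> < e)"
  proof (intro ball_cong refl all_cong1 imp_cong)
    fix x and e :: real assume x: "x \<in> U" and e: "0 < e"
    show "(\<exists>V. openin (subtopology (Rn_top d) U) V \<and> x \<in> V \<and> (\<forall>y\<in>V. \<bar>g y - g x\<bar> < e)) \<longleftrightarrow>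
      (\<exists>r>0. \<forall>y\<in>U. (\<forall>i<d. \<bar>y i - x i\<bar> < r) \<longrightarrow> \<bar>g y - g x\<bar> < e)"
    proof
      assume "\<exists>V. openin (subtopology (Rn_top d) U) V \<and> x \<in> V \<and> (\<forall>y\<in>V. \<bar>g y - g x\<bar> < e)"
      then obtain V where V: "openin (Rn_top d) V" "x \<in> V" "\<forall>y\<in>V. \<bar>g y - g x\<bar> < e"
        using U openin_open_subtopology by blast
      then show "\<exists>r>0. \<forall>y\<in>U. (\<forall>i<d. \<bar>y i - x i\<bar> < r) \<longrightarrow> \<bar>g y - g x\<bar> < e"
        unfolding openin_Rn_top_iff using sub by (meson subsetD)
    next
      assume "\<exists>r>0. \<forall>y\<in>U. (\<forall>i<d. \<bar>y i - x i\<bar> < r) \<longrightarrow> \<bar>g y - g x\<bar> < e"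
      then obtain r where r: "r > 0" "\<forall>y\<in>U. (\<forall>i<d. \<bar>y i - x i\<bar> < r) \<longrightarrow> \<bar>g y - g x\<bar> < e" by blast
      define V where "V = (\<Pi>\<^sub>E i\<in>{..<d}. ball (x i) r)"
      have "openin (Rn_top d) V" unfolding V_def Rn_top_def
        by (subst openin_PiE_gen) auto
      then have "openin (subtopology (Rn_top d) U) (V \<inter> U)" using U by (simp add: openin_subtopology_Int)
      moreover have "x \<in> V \<inter> U" using x r(1) sub by (auto simp: V_def Rn_def PiE_iff)
      moreover have "\<forall>y\<in>V \<inter> U. \<bar>g y - g x\<bar> < e"
        using r(2) by (auto simp: V_def PiE_iff dist_real_def abs_minus_commute)
      ultimately show "\<exists>V. openin (subtopology (Rn_top d) U) V \<and> x \<in> V \<and> (\<forall>y\<in>V. \<bar>g y - g x\<bar> < e)"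
        by blast
    qed
  qed
  finally show ?thesis .
qed

lemma Rn_fun_upd: "x \<in> Rn d \<Longrightarrow> i < d \<Longrightarrow> x(i := t) \<in> Rn d"
  by (auto simp: Rn_def PiE_iff extensional_def)

lemma Rn_eqI: "x \<in> Rn d \<Longrightarrow> y \<in> Rn d \<Longrightarrow> (\<And>i. i < d \<Longrightarrow> x i = y i) \<Longrightarrow> x = y"
  unfolding Rn_def by (rule PiE_ext) auto

text \<open>Walk from \<open>x\<close> to \<open>y\<close> along a staircase that changes one
  coordinate at a time; each step is a one-dimensional mean value inequality. All intermediate
  points lie in the box spanned by \<open>x\<close> and \<open>y\<close>, which is why the
  hypotheses are local to it.\<close>

lemma partial_deriv_mean_value:
  assumes x: "x \<in> Rn d" and y: "y \<in> Rn d"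
    and diff: "\<And>i z. i < d \<Longrightarrow> z \<in> Rn d \<Longrightarrow> (\<And>j. j < d \<Longrightarrow> z j \<in> closed_segment (x j) (y j)) \<Longrightarrow>
       (\<lambda>t. g (z(i := t))) differentiable (at (z i))"
    and bound: "\<And>i z. i < d \<Longrightarrow> z \<in> Rn d \<Longrightarrow> (\<And>j. j < d \<Longrightarrow> z j \<in> closed_segment (x j) (y j)) \<Longrightarrow>
       \<bar>partial_deriv i g z\<bar> \<le> K"
  shows "\<bar>g y - g x\<bar> \<le> K * (\<Sum>i<d. \<bar>y i - x i\<bar>)"
proof -
  define w where "w k = (\<lambda>i\<in>{..<d}. if i < k then y i else x i)" for k
  have w_Rn: "w k \<in> Rn d" for k by (auto simp: w_def Rn_def)
  have step: "\<bar>g (w (Suc k)) - g (w k)\<bar> \<le> K * \<bar>y k - x k\<bar>" if k: "k < d" for k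
  proof -
    define z where "z t = (w k)(k := t)" for t
    have zk: "z (x k) = w k" "z (y k) = w (Suc k)"
      using k by (auto simp: z_def w_def fun_eq_iff)
    have z_in: "z t \<in> Rn d" "\<And>j. j < d \<Longrightarrow> z t j \<in> closed_segment (x j) (y j)"
      if "t \<in> closed_segment (x k) (y k)" for t
      using that k w_Rn[of k] by (auto simp: z_def Rn_fun_upd) (auto simp: w_def)
    have "((\<lambda>s. g (z s)) has_field_derivative partial_deriv k g (z t)) (at t)"
      if "t \<in> closed_segment (x k) (y k)" for t
      using diff[OF k z_in[OF that]] unfolding partial_deriv_def DERIV_deriv_iff_real_differentiable[symmetric]
      by (simp add: z_def)
    then have "norm (g (z (y k)) - g (z (x k))) \<le> K * norm (y k - x k)"
      by (intro field_differentiable_bound[where S="closed_segment (x k) (y k)"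
            and f'="\<lambda>t. partial_deriv k g (z t)"])
         (auto intro: has_field_derivative_at_within bound[OF k z_in] simp del: closed_segment_eq_real_ivl)
    then show ?thesis by (simp add: zk)
  qed
  have "w 0 = x" "w d = y"
    by (rule Rn_eqI[OF w_Rn x], simp add: w_def, rule Rn_eqI[OF w_Rn y], simp add: w_def)
  then have "g y - g x = (\<Sum>k<d. g (w (Suc k)) - g (w k))"
    using sum_lessThan_telescope[of "\<lambda>k. g (w k)" d] by simp
  also have "\<bar>\<dots>\<bar> \<le> (\<Sum>k<d. K * \<bar>y k - x k\<bar>)"
    by (rule order_trans[OF sum_abs]) (auto intro!: sum_mono step)
  finally show ?thesis by (simp add: sum_distrib_left)
qed

text \<open>\<open>C1_on\<close> speaks only of partial derivatives, so continuity has to be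
  derived: the partials are continuous, hence bounded by some \<open>K\<close> near the point, and
  the staircase estimate applies on a small box.\<close>

lemma C1_on_imp_continuous:
  assumes U: "openin (Rn_top d) U" and g: "C1_on d U g"
  shows "continuous_map (subtopology (Rn_top d) U) euclideanreal g"
  unfolding continuous_map_Rn_iff[OF U]
proof (intro ballI allI impI)
  fix x and e :: real assume x: "x \<in> U" and e: "e > 0"
  have sub: "U \<subseteq> Rn d" using U by (simp add: openin_Rn_top_iff)
  obtain r0 where r0: "r0 > 0" "\<And>y. y \<in> Rn d \<Longrightarrow> (\<forall>i<d. \<bar>y i - x i\<bar> < r0) \<Longrightarrow> y \<in> U"
    using U x unfolding openin_Rn_top_iff by blast
  have "\<exists>r>0. \<forall>y\<in>U. (\<forall>j<d. \<bar>y j - x j\<bar> < r) \<longrightarrow> \<bar>partial_deriv i g y - partial_deriv i g x\<bar> < 1"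
    if "i < d" for i
    using g that x unfolding C1_on_def continuous_map_Rn_iff[OF U] by (meson zero_less_one)
  then obtain r where r: "\<And>i. i < d \<Longrightarrow> r i > 0"
    "\<And>i y. i < d \<Longrightarrow> y \<in> U \<Longrightarrow> (\<forall>j<d. \<bar>y j - x j\<bar> < r i) \<Longrightarrow>
       \<bar>partial_deriv i g y - partial_deriv i g x\<bar> < 1"
    by metis
  define K where "K = 1 + (\<Sum>i<d. \<bar>partial_deriv i g x\<bar>)"
  have K: "K \<ge> 1" by (simp add: K_def sum_nonneg)
  \<comment> \<open>The radius keeps the box inside \<open>U\<close> and keeps every partial
    derivative within 1 of its value at \<open>x\<close>. The factor \<open>d + 1\<close> instead of
    \<open>d\<close> makes the last inequality strict and avoids dividing by 0.\<close>
  define R where "R = Min (insert r0 (insert (e / (K * (d + 1))) (r ` {..<d})))"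
  have "R > 0" unfolding R_def using r r0 K e by (subst Min_gr_iff) auto
  have R: "R \<le> r0" "R \<le> e / (K * (d + 1))" "\<And>i. i < d \<Longrightarrow> R \<le> r i"
    unfolding R_def by (intro Min_le; simp)+
  have "\<bar>g y - g x\<bar> < e" if y: "y \<in> U" "\<forall>i<d. \<bar>y i - x i\<bar> < R" for y
  proof -
    have z: "\<bar>z j - x j\<bar> < R" if "\<And>j. j < d \<Longrightarrow> z j \<in> closed_segment (x j) (y j)" "j < d" for z j
      using that(1)[of j] that(2) y(2) by (auto simp: closed_segment_eq_real_ivl split: if_splits)
    have zU: "z \<in> U" if "z \<in> Rn d" "\<And>j. j < d \<Longrightarrow> z j \<in> closed_segment (x j) (y j)" for z
      using r0(2)[OF that(1)] z[OF that(2)] R(1) by (meson order_less_le_trans)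
    have "\<bar>g y - g x\<bar> \<le> K * (\<Sum>i<d. \<bar>y i - x i\<bar>)"
    proof (rule partial_deriv_mean_value)
      fix i z assume A: "i < d" "z \<in> Rn d" "\<And>j. j < d \<Longrightarrow> z j \<in> closed_segment (x j) (y j)"
      show "(\<lambda>t. g (z(i := t))) differentiable at (z i)"
        using g A zU unfolding C1_on_def by blast
      have "\<bar>partial_deriv i g z - partial_deriv i g x\<bar> < 1"
        using r(2)[OF A(1) zU] A z R(3) by (meson order_less_le_trans)
      moreover have "\<bar>partial_deriv i g x\<bar> \<le> (\<Sum>i<d. \<bar>partial_deriv i g x\<bar>)"
        using A(1) by (intro member_le_sum) auto
      ultimately show "\<bar>partial_deriv i g z\<bar> \<le> K" unfolding K_def by linarith
    qed (use x y sub in auto)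
    also have "\<dots> \<le> K * (\<Sum>i<d. R)" using y K by (intro mult_left_mono sum_mono) (auto intro: less_imp_le)
    also have "\<dots> = K * d * R" by simp
    also have "\<dots> < K * (d + 1) * R" using K \<open>R > 0\<close> by simp
    also have "\<dots> \<le> e" using mult_left_mono[OF R(2), of "K * (d + 1)"] K by simp
    finally show ?thesis .
  qed
  then show "\<exists>r>0. \<forall>y\<in>U. (\<forall>i<d. \<bar>y i - x i\<bar> < r) \<longrightarrow> \<bar>g y - g x\<bar> < e"
    using \<open>R > 0\<close> by blast
qed

text \<open>On the full type of real sequences the Borel and the product sigma-algebra agree. Pull
  \<open>V\<close> back along restriction to an open set of sequences, then back again along padding
  with \<open>undefined\<close>; on \<open>Rn d\<close> the two maps compose to the
  identity.\<close>

lemma open_in_sets_Rn_lborel: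
  assumes "openin (Rn_top d) V"
  shows "V \<in> sets (Rn_lborel d)"
proof -
  let ?r = "\<lambda>x::nat \<Rightarrow> real. restrict x {..<d}"
  have "continuous_map euclidean (Rn_top d) ?r"
    unfolding Rn_top_def continuous_map_componentwise
    by (auto simp: continuous_map_iff_continuous2 intro!: continuous_intros)
  then have "open (?r -` V)"
    using openin_continuous_map_preimage[OF _ assms] by (fastforce simp: vimage_def)
  then have "?r -` V \<in> sets borel" by simp
  then have S: "?r -` V \<in> sets (\<Pi>\<^sub>M i\<in>UNIV. borel)" by (simp add: sets_PiM_equal_borel)
  have "(\<lambda>x. \<lambda>i\<in>UNIV. if i < d then x i else undefined) \<in> measurable (Rn_lborel d) (\<Pi>\<^sub>M i\<in>UNIV. borel)"
    unfolding Rn_lborel_def by (intro measurable_restrict, rename_tac i, case_tac "i < d") auto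
  from measurable_sets[OF this S] have
   "{x \<in> Rn d. ?r (\<lambda>i. if i < d then x i else undefined) \<in> V} \<in> sets (Rn_lborel d)"
    by (simp add: vimage_def space_Rn_lborel Int_def conj_commute lessThan_def)
  also have "{x \<in> Rn d. ?r (\<lambda>i. if i < d then x i else undefined) \<in> V} = V"
  proof -
    have "?r (\<lambda>i. if i < d then x i else undefined) = x" if "x \<in> Rn d" for x
      using that by (auto simp: Rn_def PiE_iff extensional_def fun_eq_iff)
    moreover have "V \<subseteq> Rn d" using assms by (simp add: openin_Rn_top_iff)
    ultimately show ?thesis by auto
  qed
  finally show ?thesis .
qed

lemma continuous_imp_borel_measurable_Rn:
  assumes "continuous_map (Rn_top d) euclideanreal g"
  shows "g \<in> borel_measurable (Rn_lborel d)"
proof (rule borel_measurableI)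
  fix S :: "real set" assume "open S"
  then have "openin (Rn_top d) {x \<in> topspace (Rn_top d). g x \<in> S}"
    using assms by (intro openin_continuous_map_preimage) auto
  then show "g -` S \<inter> space (Rn_lborel d) \<in> sets (Rn_lborel d)"
    using open_in_sets_Rn_lborel by (simp add: topspace_Rn_top space_Rn_lborel vimage_def Int_def conj_commute)
qed


section \<open>The fractional Hardy inequality on a half-line\<close>

text \<open>Convexity of the power, applied to \<open>a + b\<close> written as the convex
  combination of \<open>a / \<theta>\<close> and \<open>b / (1 - \<theta>)\<close>. For \<theta>
  near 1 the factor of \<open>a powr p\<close> is near 1, which is what an absorption argument
  needs.\<close>

lemma powr_add_le_weighted:
  fixes a b p \<theta> :: real
  assumes "1 < p" "0 \<le> a" "0 \<le> b" "0 < \<theta>" "\<theta> < 1"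
  shows "(a + b) powr p \<le> \<theta> powr (1 - p) * a powr p + (1 - \<theta>) powr (1 - p) * b powr p"
proof (cases "a = 0 \<or> b = 0")
  case True
  have *: "1 \<le> x powr (1 - p)" if "0 < x" "x < 1" for x :: real
    using that assms(1) by (simp add: powr_le_one_le ge_one_powr_ge_zero powr_minus_divide
      powr_mono2' [of "1 - p" x 1, simplified])
  show ?thesis
    using True *[of \<theta>] *[of "1 - \<theta>"] assms
    by (auto intro: mult_right_mono[of 1 _ "_ powr p", simplified])
next
  case False
  then have pos: "0 < a" "0 < b" using assms by auto
  have "((1 - \<theta>) * (b / (1 - \<theta>)) + \<theta> * (a / \<theta>)) powr p \<le>
      (1 - \<theta>) * (b / (1 - \<theta>)) powr p + \<theta> * (a / \<theta>) powr p"
    using convex_onD[OF powr_convex[of p], of \<theta> "b / (1 - \<theta>)" "a / \<theta>"] assms pos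
    by (simp del: times_divide_eq_right)
  moreover have "x * (c / x) powr p = x powr (1 - p) * c powr p" if "0 < x" "0 < c" for x c :: real
    using that by (simp add: powr_divide powr_diff)
  ultimately show ?thesis using assms pos by (simp add: add.commute)
qed

section \<open>Coordinatewise affine changes of variables\<close>

lemma product_sigma_finite_lborel: "product_sigma_finite (\<lambda>_. lborel)"
  by (simp add: product_sigma_finite_def sigma_finite_lborel)

text \<open>Fubini peels off one coordinate at a time, and each is a one-dimensional substitution.
  This diagonal form covers the reflections, translations and dilations used later.\<close>

lemma nn_integral_PiM_lborel_affine:
  fixes b c :: "'i \<Rightarrow> real"
  assumes "finite I" "F \<in> borel_measurable (Pi\<^sub>M I (\<lambda>_. lborel))" "\<And>i. i \<in> I \<Longrightarrow> b i \<noteq> 0"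
  shows "(\<integral>\<^sup>+x. F x \<partial>Pi\<^sub>M I (\<lambda>_. lborel)) =
    (\<Prod>i\<in>I. ennreal \<bar>b i\<bar>) * (\<integral>\<^sup>+x. F (\<lambda>i\<in>I. c i + b i * x i) \<partial>Pi\<^sub>M I (\<lambda>_. lborel))"
  using assms
proof (induction I arbitrary: F rule: finite_induct)
  case empty
  interpret product_sigma_finite "\<lambda>_::'i. lborel :: real measure" by (rule product_sigma_finite_lborel)
  show ?case by (simp add: PiM_empty nn_integral_count_space_finite)
next
  case (insert j I)
  interpret product_sigma_finite "\<lambda>_::'i. lborel :: real measure" by (rule product_sigma_finite_lborel)
  note [measurable] = insert.prems(1)
  let ?P = "Pi\<^sub>M I (\<lambda>_::'i. lborel :: real measure)"
  let ?G = "\<lambda>x. \<integral>\<^sup>+y. F (x(j := c j + b j * y)) \<partial>lborel"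
  have [measurable]: "(\<lambda>y. F (x(j := y))) \<in> borel_measurable borel" if "x \<in> space ?P" for x
    using measurable_comp[OF measurable_component_update[OF that insert.hyps(2)] insert.prems(1)]
    by (simp add: comp_def)
  have [measurable]: "(\<lambda>(x, y). F (x(j := c j + b j * y))) \<in> borel_measurable (?P \<Otimes>\<^sub>M lborel)"
    by measurable
  have "(\<integral>\<^sup>+x. F x \<partial>Pi\<^sub>M (insert j I) (\<lambda>_. lborel)) = (\<integral>\<^sup>+x. \<integral>\<^sup>+y. F (x(j := y)) \<partial>lborel \<partial>?P)"
    by (rule product_nn_integral_insert) (use insert in auto)
  also have "\<dots> = (\<integral>\<^sup>+x. ennreal \<bar>b j\<bar> * ?G x \<partial>?P)"
    using insert.prems(2)
    by (intro nn_integral_cong nn_integral_real_affine) auto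
  also have "\<dots> = ennreal \<bar>b j\<bar> * (\<integral>\<^sup>+x. ?G x \<partial>?P)"
    by (rule nn_integral_cmult) measurable
  also have "(\<integral>\<^sup>+x. ?G x \<partial>?P) = (\<Prod>i\<in>I. ennreal \<bar>b i\<bar>) * (\<integral>\<^sup>+x. ?G (\<lambda>i\<in>I. c i + b i * x i) \<partial>?P)"
    proof (rule insert.IH)
    show "?G \<in> borel_measurable ?P" by (rule lborel.borel_measurable_nn_integral) measurable
  qed (use insert.prems(2) in auto)
  also have "(\<integral>\<^sup>+x. ?G (\<lambda>i\<in>I. c i + b i * x i) \<partial>?P) =
     (\<integral>\<^sup>+x. F (\<lambda>i\<in>insert j I. c i + b i * x i) \<partial>Pi\<^sub>M (insert j I) (\<lambda>_. lborel))"
  proof -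
    have eq: "(\<lambda>i\<in>I. c i + b i * x i)(j := c j + b j * y) = (\<lambda>i\<in>insert j I. c i + b i * (x(j := y)) i)" for x y
      using insert.hyps by (auto simp: fun_eq_iff)
    have "(\<lambda>x. F (\<lambda>i\<in>insert j I. c i + b i * x i)) \<in> borel_measurable (Pi\<^sub>M (insert j I) (\<lambda>_. lborel))"
      by measurable
    from product_nn_integral_insert[OF insert.hyps this] show ?thesis
      by (simp only: eq)
  qed
  finally show ?case using insert.hyps by (simp only: prod.insert mult.assoc not_False_eq_True)
qed

text \<open>
  Comparing \<open>g t\<close> with \<open>g (x t)\<close>, the weighted norm of the dilate is \<open>x\<^sup>\<sigma>\<^sup>-\<^sup>1\<close> times that of
  \<open>g\<close>. Dilating up for \<open>\<sigma> < 1\<close> and down for \<open>\<sigma> > 1\<close> makes this factor small enough to be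
  absorbed; the support condition makes the absorbed norm finite. Averaging over \<open>x\<close> then
  produces the double integral.
\<close>

lemma hardy_half_line:
  fixes p \<sigma> :: real
  assumes p: "1 < p" and \<sigma>: "0 < \<sigma>" "\<sigma> \<noteq> 1"
  shows "\<exists>C>0. \<forall>g::real \<Rightarrow> real. g \<in> borel_measurable borel \<longrightarrow>
     (\<exists>\<delta>>0. \<exists>R K. \<forall>t. \<bar>g t\<bar> \<le> K \<and> (g t \<noteq> 0 \<longrightarrow> \<delta> \<le> t \<and> t \<le> R)) \<longrightarrow>
     (\<integral>\<^sup>+t. indicator {0<..} t * ennreal (\<bar>g t\<bar> powr p / t powr \<sigma>) \<partial>lborel) \<le>
     ennreal C * (\<integral>\<^sup>+t. \<integral>\<^sup>+t'. indicator {0<..} t * indicator {0<..} t' *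
        ennreal (\<bar>g t - g t'\<bar> powr p / \<bar>t - t'\<bar> powr (1 + \<sigma>)) \<partial>lborel \<partial>lborel)"
proof -
  \<comment> \<open>The worst value of the dilation factor \<open>x powr (\<sigma> - 1)\<close> over
    the range of dilations chosen below; it is less than 1 because \<sigma> differs from 1.\<close>
  define q :: real where "q = 2 powr (- \<bar>\<sigma> - 1\<bar>)"
  have q: "0 < q" "q < 1" using \<sigma> unfolding q_def by (auto simp: powr_less_one)
  \<comment> \<open>Chosen so that the convexity factor costs exactly \<open>q powr (-1/2)\<close>:
    the product with the dilation factor is then \<open>sqrt q\<close>, still below 1.\<close>
  define \<theta> where "\<theta> = q powr (1 / (2 * (p - 1)))"
  have \<theta>: "0 < \<theta>" "\<theta> < 1" using q p unfolding \<theta>_def by (auto simp: powr_less_one powr01_less_one)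
  have \<theta>q: "\<theta> powr (1 - p) * q = sqrt q"
  proof -
    have "\<theta> powr (1 - p) = q powr (- (1/2))"
    proof -
      have "1 / (2 * (p - 1)) * (1 - p) = - (1 / 2)" using p by (simp add: field_simps)
      then show ?thesis unfolding \<theta>_def powr_powr by simp
    qed
    moreover have "q powr (- (1/2)) * q powr 1 = q powr (1/2)"
      by (simp only: powr_add[symmetric]) simp
    ultimately show ?thesis using q by (simp add: powr_half_sqrt)
  qed
  define B where "B = (1 - \<theta>) powr (1 - p)"
  have B: "B > 0" using \<theta> unfolding B_def by simp
  \<comment> \<open>Dilations range over \<open>{l..2*l}\<close>, that is [2, 4] or [1/4, 1/2]. Both
    intervals avoid 1, so \<open>t\<close> and \<open>x * t\<close> are distinct, and both keep
    their distance below \<open>3 * t\<close>.\<close>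
  define l :: real where "l = (if \<sigma> < 1 then 2 else 1/4)"
  have l: "l > 0" unfolding l_def by auto
  have lpow: "x powr (\<sigma> - 1) \<le> q" if "l \<le> x" "x \<le> 2 * l" for x
  proof (cases "\<sigma> < 1")
    case True
    then have "x powr (\<sigma> - 1) \<le> 2 powr (\<sigma> - 1)" using that by (intro powr_mono2') (auto simp: l_def)
    then show ?thesis using True by (simp add: q_def)
  next
    case False
    then have "x powr (\<sigma> - 1) \<le> (1/2) powr (\<sigma> - 1)" using that by (intro powr_mono2) (auto simp: l_def)
    also have "\<dots> = 2 powr (- (\<sigma> - 1))" using powr_minus_divide[of 2 "\<sigma> - 1"] by (simp add: powr_divide)
    finally show ?thesis using False by (simp add: q_def)
  qed
  have ldist: "0 < \<bar>t - t'\<bar> \<and> \<bar>t - t'\<bar> \<le> 3 * t" if "t > 0" "l * t \<le> t'" "t' \<le> 2 * l * t" for t t'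
  proof (cases "\<sigma> < 1")
    case True with that show ?thesis by (auto simp: l_def)
  next
    case False with that show ?thesis by (auto simp: l_def)
  qed
  define k where "k = sqrt q"
  have k: "0 < k" "k < 1" using q by (auto simp: k_def)
  \<comment> \<open>\<open>B / (1 - k)\<close> is the price of absorption,
    \<open>3 powr (1 + \<sigma>)\<close> that of comparing \<open>t\<close> with the distance of the
    two points, and \<open>l\<close> is the length of the interval of dilations.\<close>
  define C where "C = B / (1 - k) * 3 powr (1 + \<sigma>) / l"
  have C: "C > 0" using B k l by (simp add: C_def)
  show ?thesis
  proof (intro exI[of _ C] conjI C allI impI)
    fix g :: "real \<Rightarrow> real"
    assume [measurable]: "g \<in> borel_measurable borel"
    assume "\<exists>\<delta>>0. \<exists>R K. \<forall>t. \<bar>g t\<bar> \<le> K \<and> (g t \<noteq> 0 \<longrightarrow> \<delta> \<le> t \<and> t \<le> R)"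
    then obtain \<delta> R K where \<delta>: "\<delta> > 0" and gK: "\<And>t. \<bar>g t\<bar> \<le> K" and
      supp: "\<And>t. g t \<noteq> 0 \<Longrightarrow> \<delta> \<le> t \<and> t \<le> R" by blast
    define N where "N = (\<integral>\<^sup>+t. indicator {0<..} t * ennreal (\<bar>g t\<bar> powr p / t powr \<sigma>) \<partial>lborel)"
    define E where "E = (\<integral>\<^sup>+t. \<integral>\<^sup>+t'. indicator {0<..} t * indicator {0<..} t' *
        ennreal (\<bar>g t - g t'\<bar> powr p / \<bar>t - t'\<bar> powr (1 + \<sigma>)) \<partial>lborel \<partial>lborel)"
    have "N \<le> (\<integral>\<^sup>+t. ennreal (K powr p / \<delta> powr \<sigma>) * indicator {\<delta>..R} t \<partial>lborel)"
      unfolding N_def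
    proof (rule nn_integral_mono)
      fix t
      have "\<bar>g t\<bar> powr p / t powr \<sigma> \<le> K powr p / \<delta> powr \<sigma>" if "g t \<noteq> 0"
        using supp[OF that] gK[of t] \<delta> p \<sigma> by (intro frac_le powr_mono2) auto
      then show "indicator {0<..} t * ennreal (\<bar>g t\<bar> powr p / t powr \<sigma>)
         \<le> ennreal (K powr p / \<delta> powr \<sigma>) * indicator {\<delta>..R} t"
        using supp[of t] by (cases "g t = 0") (auto simp: indicator_def intro!: ennreal_leI)
    qed
    also have "\<dots> < \<top>" by (simp add: nn_integral_cmult_indicator ennreal_mult_less_top emeasure_lborel_Icc_eq)
    finally have Nfin: "N < \<top>" .
    define J where "J x = (\<integral>\<^sup>+t. indicator {0<..} t * ennreal (\<bar>g t - g (x * t)\<bar> powr p / t powr \<sigma>) \<partial>lborel)" for x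
    have main: "N \<le> ennreal (B / (1 - k)) * J x" if x: "l \<le> x" "x \<le> 2 * l" for x
    proof -
      have x0: "x > 0" using x l by linarith
      have scale: "(\<integral>\<^sup>+t. indicator {0<..} t * ennreal (\<bar>g (x * t)\<bar> powr p / t powr \<sigma>) \<partial>lborel)
         = ennreal (x powr (\<sigma> - 1)) * N"
      proof -
        have "N = ennreal x * (\<integral>\<^sup>+t. indicator {0<..} (x * t) * ennreal (\<bar>g (x * t)\<bar> powr p / (x * t) powr \<sigma>) \<partial>lborel)"
          unfolding N_def using x0 by (subst nn_integral_real_affine[where c=x and t=0]) auto
        also have "(\<integral>\<^sup>+t. indicator {0<..} (x * t) * ennreal (\<bar>g (x * t)\<bar> powr p / (x * t) powr \<sigma>) \<partial>lborel)
           = (\<integral>\<^sup>+t. ennreal (x powr (- \<sigma>)) * (indicator {0<..} t * ennreal (\<bar>g (x * t)\<bar> powr p / t powr \<sigma>)) \<partial>lborel)"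
          using x0 by (intro nn_integral_cong)
            (auto simp: indicator_def zero_less_mult_iff powr_mult powr_minus_divide ennreal_mult[symmetric])
        also have "\<dots> = ennreal (x powr (- \<sigma>)) * (\<integral>\<^sup>+t. indicator {0<..} t * ennreal (\<bar>g (x * t)\<bar> powr p / t powr \<sigma>) \<partial>lborel)"
          by (rule nn_integral_cmult) measurable
        finally have "ennreal (x powr (\<sigma> - 1)) * N = ennreal (x powr (\<sigma> - 1) * x * x powr (- \<sigma>)) *
          (\<integral>\<^sup>+t. indicator {0<..} t * ennreal (\<bar>g (x * t)\<bar> powr p / t powr \<sigma>) \<partial>lborel)"
          using x0 by (simp add: ennreal_mult mult.assoc)
        moreover have "x powr (\<sigma> - 1) * x * x powr (- \<sigma>) = 1"
          using x0 by (simp add: powr_diff powr_minus field_simps)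
        ultimately show ?thesis by simp
      qed
      have "N \<le> (\<integral>\<^sup>+t. ennreal (\<theta> powr (1 - p)) * (indicator {0<..} t * ennreal (\<bar>g (x * t)\<bar> powr p / t powr \<sigma>))
         + ennreal B * (indicator {0<..} t * ennreal (\<bar>g t - g (x * t)\<bar> powr p / t powr \<sigma>)) \<partial>lborel)"
        unfolding N_def
      proof (rule nn_integral_mono)
        fix t
        have "\<bar>g t\<bar> powr p \<le> (\<bar>g (x * t)\<bar> + \<bar>g t - g (x * t)\<bar>) powr p"
          using p by (intro powr_mono2) auto
        also have "\<dots> \<le> \<theta> powr (1 - p) * \<bar>g (x * t)\<bar> powr p + B * \<bar>g t - g (x * t)\<bar> powr p"
          unfolding B_def using p \<theta> by (intro powr_add_le_weighted) auto
        finally have "\<bar>g t\<bar> powr p / t powr \<sigma> \<le>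
           \<theta> powr (1 - p) * (\<bar>g (x * t)\<bar> powr p / t powr \<sigma>) + B * (\<bar>g t - g (x * t)\<bar> powr p / t powr \<sigma>)"
          by (simp add: add_divide_distrib[symmetric] divide_right_mono)
        then show "indicator {0<..} t * ennreal (\<bar>g t\<bar> powr p / t powr \<sigma>) \<le>
          ennreal (\<theta> powr (1 - p)) * (indicator {0<..} t * ennreal (\<bar>g (x * t)\<bar> powr p / t powr \<sigma>))
         + ennreal B * (indicator {0<..} t * ennreal (\<bar>g t - g (x * t)\<bar> powr p / t powr \<sigma>))"
          using B by (auto simp: indicator_def ennreal_mult[symmetric] ennreal_plus[symmetric] simp del: ennreal_plus intro!: ennreal_leI)
      qed
      also have "\<dots> = ennreal (\<theta> powr (1 - p)) * (ennreal (x powr (\<sigma> - 1)) * N) + ennreal B * J x"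
        unfolding scale[symmetric] J_def by (subst nn_integral_add) (auto simp: nn_integral_cmult)
      also have "\<dots> \<le> ennreal k * N + ennreal B * J x"
      proof -
        have "\<theta> powr (1 - p) * x powr (\<sigma> - 1) \<le> k"
          unfolding k_def \<theta>q[symmetric] using lpow[OF x] by (intro mult_left_mono) auto
        then show ?thesis
          by (auto simp: mult.assoc[symmetric] ennreal_mult[symmetric] intro!: add_right_mono mult_right_mono ennreal_leI)
      qed
      finally have le: "N \<le> ennreal k * N + ennreal B * J x" .
      show ?thesis
      proof (cases "J x = \<top>")
        case True
        then show ?thesis using B k by (simp add: ennreal_mult_top)
      next
        case False
        obtain n where n: "N = ennreal n" "n \<ge> 0" using Nfin by (cases N) auto
        obtain j where j: "J x = ennreal j" "j \<ge> 0" using False by (cases "J x") auto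
        have "ennreal n \<le> ennreal (k * n + B * j)"
          using le n j k B by (simp add: ennreal_mult)
        then have "n \<le> k * n + B * j" using n j k B by (subst (asm) ennreal_le_iff) auto
        then have "n \<le> B / (1 - k) * j" using k by (simp add: field_simps)
        then show ?thesis using n j k B by (simp add: ennreal_mult[symmetric] ennreal_leI)
      qed
    qed
    \<comment> \<open>The bound holds for each single dilation; integrating it over an interval of
      length \<open>l\<close> creates the second integration variable.\<close>
    have "ennreal l * N = (\<integral>\<^sup>+x. N * indicator {l..2*l} x \<partial>lborel)"
      using l by (simp add: nn_integral_cmult_indicator mult.commute)
    also have "\<dots> \<le> (\<integral>\<^sup>+x. ennreal (B / (1 - k)) * (J x * indicator {l..2*l} x) \<partial>lborel)"
      using main by (intro nn_integral_mono) (auto simp: indicator_def)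
    also have "\<dots> = ennreal (B / (1 - k)) * (\<integral>\<^sup>+x. J x * indicator {l..2*l} x \<partial>lborel)"
      unfolding J_def by (rule nn_integral_cmult) measurable
    also have "(\<integral>\<^sup>+x. J x * indicator {l..2*l} x \<partial>lborel) =
       (\<integral>\<^sup>+x. \<integral>\<^sup>+t. indicator {0<..} t * ennreal (\<bar>g t - g (x * t)\<bar> powr p / t powr \<sigma>) * indicator {l..2*l} x \<partial>lborel \<partial>lborel)"
      unfolding J_def by (subst nn_integral_multc) auto
    also have "\<dots> = (\<integral>\<^sup>+t. \<integral>\<^sup>+x. indicator {0<..} t * ennreal (\<bar>g t - g (x * t)\<bar> powr p / t powr \<sigma>) * indicator {l..2*l} x \<partial>lborel \<partial>lborel)"
      by (rule lborel_pair.Fubini') measurable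
    also have "\<dots> \<le> (\<integral>\<^sup>+t. \<integral>\<^sup>+t'. ennreal (3 powr (1 + \<sigma>)) * (indicator {0<..} t * indicator {0<..} t' *
        ennreal (\<bar>g t - g t'\<bar> powr p / \<bar>t - t'\<bar> powr (1 + \<sigma>))) \<partial>lborel \<partial>lborel)"
    proof (rule nn_integral_mono)
      fix t :: real
      show "(\<integral>\<^sup>+x. indicator {0<..} t * ennreal (\<bar>g t - g (x * t)\<bar> powr p / t powr \<sigma>) * indicator {l..2*l} x \<partial>lborel)
        \<le> (\<integral>\<^sup>+t'. ennreal (3 powr (1 + \<sigma>)) * (indicator {0<..} t * indicator {0<..} t' *
        ennreal (\<bar>g t - g t'\<bar> powr p / \<bar>t - t'\<bar> powr (1 + \<sigma>))) \<partial>lborel)" (is "?L \<le> ?R")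
      proof (cases "t > 0")
        case t: True
        \<comment> \<open>The substitution \<open>t' = t * x\<close> contributes a factor
          \<open>t\<close>. Together with \<open>t powr \<sigma>\<close> it matches the kernel
          exponent \<open>1 + \<sigma>\<close>, since the distance is at most
          \<open>3 * t\<close>.\<close>
        have "?R = ennreal t * (\<integral>\<^sup>+x. ennreal (3 powr (1 + \<sigma>)) * (indicator {0<..} t * indicator {0<..} (t * x) *
            ennreal (\<bar>g t - g (t * x)\<bar> powr p / \<bar>t - t * x\<bar> powr (1 + \<sigma>))) \<partial>lborel)"
          using t by (subst nn_integral_real_affine[where c=t and t=0]) auto
        also have "\<dots> = (\<integral>\<^sup>+x. ennreal t * (ennreal (3 powr (1 + \<sigma>)) * (indicator {0<..} t * indicator {0<..} (t * x) *
            ennreal (\<bar>g t - g (t * x)\<bar> powr p / \<bar>t - t * x\<bar> powr (1 + \<sigma>)))) \<partial>lborel)"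
          by (rule nn_integral_cmult[symmetric]) measurable
        also have "\<dots> \<ge> ?L"
        proof (rule nn_integral_mono)
          fix x
          show "indicator {0<..} t * ennreal (\<bar>g t - g (x * t)\<bar> powr p / t powr \<sigma>) * indicator {l..2*l} x \<le>
            ennreal t * (ennreal (3 powr (1 + \<sigma>)) * (indicator {0<..} t * indicator {0<..} (t * x) *
            ennreal (\<bar>g t - g (t * x)\<bar> powr p / \<bar>t - t * x\<bar> powr (1 + \<sigma>))))"
          proof (cases "x \<in> {l..2*l}")
            case x: True
            have tx: "t * x > 0" using x l t by auto
            have d: "0 < \<bar>t - t * x\<bar>" "\<bar>t - t * x\<bar> \<le> 3 * t"
              using ldist[of t "t * x"] x t by (auto simp: mult.commute)
            have "\<bar>t - t * x\<bar> powr (1 + \<sigma>) \<le> (3 * t) powr (1 + \<sigma>)"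
              using d \<sigma> by (intro powr_mono2) auto
            also have "\<dots> = 3 powr (1 + \<sigma>) * (t * t powr \<sigma>)" using t by (simp add: powr_mult powr_add)
            finally have "\<bar>g t - g (t * x)\<bar> powr p * \<bar>t - t * x\<bar> powr (1 + \<sigma>) \<le>
               \<bar>g t - g (t * x)\<bar> powr p * (3 powr (1 + \<sigma>) * (t * t powr \<sigma>))"
              by (rule mult_left_mono) simp
            then have "\<bar>g t - g (t * x)\<bar> powr p / t powr \<sigma> \<le>
              t * (3 powr (1 + \<sigma>) * (\<bar>g t - g (t * x)\<bar> powr p / \<bar>t - t * x\<bar> powr (1 + \<sigma>)))"
              using d t by (simp add: field_simps)
            then show ?thesis
              using x t tx by (simp add: ennreal_mult[symmetric] mult.commute[of x t] ennreal_leI)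
          qed simp
        qed
        finally show ?thesis .
      qed simp
    qed
    also have "\<dots> = ennreal (3 powr (1 + \<sigma>)) * E"
      unfolding E_def by (simp add: nn_integral_cmult)
    finally have "ennreal l * N \<le> ennreal (B / (1 - k)) * (ennreal (3 powr (1 + \<sigma>)) * E)"
      by (simp add: mult_left_mono)
    then have "ennreal (1 / l) * (ennreal l * N) \<le> ennreal (1 / l) * (ennreal (B / (1 - k)) * (ennreal (3 powr (1 + \<sigma>)) * E))"
      by (rule mult_left_mono) simp
    moreover have "ennreal (1 / l) * (ennreal l * N) = N"
      using l by (simp add: mult.assoc[symmetric] ennreal_mult[symmetric])
    moreover have "ennreal (1 / l) * (ennreal (B / (1 - k)) * (ennreal (3 powr (1 + \<sigma>)) * E)) = ennreal C * E"
    proof -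
      have "C = 1 / l * (B / (1 - k) * 3 powr (1 + \<sigma>))" by (simp add: C_def)
      then show ?thesis using l B k by (simp only: mult.assoc[symmetric]) (simp add: ennreal_mult[symmetric])
    qed
    ultimately show "N \<le> ennreal C * E" by simp
  qed
qed


section \<open>Tails of the kernel and averages over directions\<close>

text \<open>Each half-line contributes \<open>r powr - \<sigma> / \<sigma>\<close> by an explicit
  antiderivative. This is one factor of the product majorant for the kernel in several
  dimensions.\<close>

lemma nn_integral_powr_tail_le:
  fixes r c \<sigma> :: real
  assumes "r > 0" "\<sigma> > 0"
  shows "(\<integral>\<^sup>+t. ennreal ((r + \<bar>c - t\<bar>) powr - (1 + \<sigma>)) \<partial>lborel) \<le> ennreal (2 * r powr - \<sigma> / \<sigma>)"
proof -
  let ?f = "\<lambda>t. (r + \<bar>t\<bar>) powr - (1 + \<sigma>)"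
  have half: "(\<integral>\<^sup>+t. ennreal (?f t) * indicator {0..} t \<partial>lborel) = ennreal (r powr - \<sigma> / \<sigma>)"
  proof -
    have "(\<integral>\<^sup>+t. ennreal (?f t) * indicator {0..} t \<partial>lborel) =
       (\<integral>\<^sup>+t. ennreal ((r + t) powr - (1 + \<sigma>)) * indicator {0..} t \<partial>lborel)"
      by (intro nn_integral_cong) (auto simp: indicator_def)
    also have "\<dots> = ennreal (0 - (- ((r + 0) powr - \<sigma> / \<sigma>)))"
    proof (rule nn_integral_FTC_atLeast)
      fix x :: real assume "0 \<le> x"
      then have "((\<lambda>t. (r + t) powr - \<sigma>) has_real_derivative - \<sigma> * (r + x) powr (- \<sigma> - of_nat 1) * 1) (at x)"
        using assms by (intro DERIV_fun_powr) (auto intro!: derivative_eq_intros)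
      from DERIV_minus[OF DERIV_cdivide[OF this, of \<sigma>]]
      show "((\<lambda>t. - ((r + t) powr - \<sigma> / \<sigma>)) has_real_derivative (r + x) powr - (1 + \<sigma>)) (at x)"
        using assms by (simp add: minus_diff_commute)
    next
      have "((\<lambda>t. (r + t) powr - \<sigma>) \<longlongrightarrow> 0) at_top"
        using assms by (intro tendsto_neg_powr filterlim_tendsto_add_at_top[OF tendsto_const]) (auto simp: filterlim_ident)
      from tendsto_minus[OF tendsto_divide[OF this tendsto_const[of \<sigma>]]]
      show "((\<lambda>t. - ((r + t) powr - \<sigma> / \<sigma>)) \<longlongrightarrow> 0) at_top"
        using assms by simp
    qed (auto)
    finally show ?thesis by simp
  qed
  have "(\<integral>\<^sup>+t. ennreal ((r + \<bar>c - t\<bar>) powr - (1 + \<sigma>)) \<partial>lborel) = (\<integral>\<^sup>+t. ennreal (?f t) \<partial>lborel)"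
    by (subst nn_integral_real_affine[where c="-1" and t=c]) auto
  also have "\<dots> \<le> (\<integral>\<^sup>+t. ennreal (?f t) * indicator {0..} t + ennreal (?f (- t)) * indicator {0..} (- t) \<partial>lborel)"
    by (intro nn_integral_mono) (auto simp: indicator_def)
  also have "\<dots> = (\<integral>\<^sup>+t. ennreal (?f t) * indicator {0..} t \<partial>lborel) +
      (\<integral>\<^sup>+t. ennreal (?f (- t)) * indicator {0..} (- t) \<partial>lborel)"
    by (intro nn_integral_add) auto
  also have "(\<integral>\<^sup>+t. ennreal (?f (- t)) * indicator {0..} (- t) \<partial>lborel) = (\<integral>\<^sup>+t. ennreal (?f t) * indicator {0..} t \<partial>lborel)"
    by (subst (2) nn_integral_real_affine[where c="-1" and t=0]) auto
  finally show ?thesis unfolding half using assms by (simp add: ennreal_plus[symmetric] del: ennreal_plus)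
qed

lemma Rn_norm_nonneg [simp]: "0 \<le> Rn_norm d x"
  by (simp add: Rn_norm_def)

lemma Rn_dist_nonneg [simp]: "0 \<le> Rn_dist d x y"
  by (simp add: Rn_dist_def)

lemma Rn_dist_eq_L2_set: "Rn_dist d x y = L2_set (\<lambda>i. x i - y i) {..<d}"
  unfolding Rn_dist_def Rn_norm_def Rn_minus_def by (rule L2_set_cong) auto

lemma abs_diff_le_Rn_dist: "(i::nat) < d \<Longrightarrow> \<bar>x i - y i\<bar> \<le> Rn_dist d x y"
  unfolding Rn_dist_eq_L2_set using member_le_L2_set[of "{..<d}" i "\<lambda>i. \<bar>x i - y i\<bar>"]
  by (simp add: L2_set_def)

lemma sum_abs_diff_le_Rn_dist: "(\<Sum>i<(d::nat). \<bar>x i - y i\<bar>) \<le> d * Rn_dist d x y"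
  using sum_mono[of "{..<d}" "\<lambda>i. \<bar>x i - y i\<bar>" "\<lambda>_. Rn_dist d x y"] by (simp add: abs_diff_le_Rn_dist)

lemma Rn_dist_commute: "Rn_dist d x y = Rn_dist d y x"
  unfolding Rn_dist_eq_L2_set L2_set_def by (simp add: power2_commute)

text \<open>
  Polar coordinates are avoided: for \<open>r \<le> \<bar>x - y\<bar>\<close> the kernel is dominated by a product of
  one-dimensional kernels \<open>(r + \<bar>x\<^sub>i - y\<^sub>i\<bar>)\<close> to the power \<open>- (1 + \<tau> / d)\<close>.
\<close>

lemma nn_integral_kernel_tail_le:
  fixes \<tau> :: real
  assumes d: "d > 0" and \<tau>: "\<tau> > 0"
  shows "\<exists>C>0. \<forall>(x::nat \<Rightarrow> real) r. r > 0 \<longrightarrow>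
    (\<integral>\<^sup>+y. indicator {y. r \<le> Rn_dist d x y} y * ennreal (1 / Rn_dist d x y powr (real d + \<tau>)) \<partial>Rn_lborel d)
    \<le> ennreal (C * r powr - \<tau>)"
proof -
  interpret product_sigma_finite "\<lambda>_::nat. lborel :: real measure" by (rule product_sigma_finite_lborel)
  \<comment> \<open>The excess \<tau> is shared equally among the coordinates, so that
    \<open>d\<close> factors of exponent \<open>1 + \<sigma>\<close> have total exponent
    \<open>d + \<tau>\<close>.\<close>
  define \<sigma> where "\<sigma> = \<tau> / d"
  have \<sigma>: "\<sigma> > 0" "\<sigma> * d = \<tau>" using assms by (auto simp: \<sigma>_def)
  define C where "C = 2 powr (d + \<tau>) * (2 / \<sigma>) ^ d"
  have C: "C > 0" using \<sigma> by (simp add: C_def)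
  show ?thesis
  proof (intro exI[of _ C] conjI C allI impI)
    fix x :: "nat \<Rightarrow> real" and r :: real assume r: "r > 0"
    let ?h = "\<lambda>i t. (r + \<bar>x i - t\<bar>) powr - (1 + \<sigma>)"
    have "(\<integral>\<^sup>+y. indicator {y. r \<le> Rn_dist d x y} y * ennreal (1 / Rn_dist d x y powr (real d + \<tau>)) \<partial>Rn_lborel d)
      \<le> (\<integral>\<^sup>+y. ennreal (2 powr (d + \<tau>)) * (\<Prod>i<d. ennreal (?h i (y i))) \<partial>Rn_lborel d)"
    proof (rule nn_integral_mono)
      fix y
      have "1 / Rn_dist d x y powr (real d + \<tau>) \<le> 2 powr (d + \<tau>) * (\<Prod>i<d. ?h i (y i))"
        if le: "r \<le> Rn_dist d x y"
      proof -
        let ?D = "Rn_dist d x y"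
        \<comment> \<open>Both \<open>r\<close> and each coordinate difference are at most
          \<open>?D\<close>, so each one-dimensional base is at most \<open>2 * ?D\<close>.\<close>
        have "((2 * ?D) powr - (1 + \<sigma>)) ^ d \<le> (\<Prod>i<d. ?h i (y i))"
        proof -
          have "(2 * ?D) powr - (1 + \<sigma>) \<le> ?h i (y i)" if "i < d" for i
            using abs_diff_le_Rn_dist[OF that, of x y] le r \<sigma> by (intro powr_mono2') auto
          then have "(\<Prod>i<d. (2 * ?D) powr - (1 + \<sigma>)) \<le> (\<Prod>i<d. ?h i (y i))"
            by (intro prod_mono) auto
          then show ?thesis by simp
        qed
        moreover have "((2 * ?D) powr - (1 + \<sigma>)) ^ d = (2 * ?D) powr - (d + \<tau>)"
        proof -
          have "- (1 + \<sigma>) * d = - (d + \<tau>)" using \<sigma> by (simp add: algebra_simps)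
          then show ?thesis using le r by (subst powr_realpow[symmetric]) (auto simp only: powr_powr powr_gt_zero)
        qed
        moreover have "1 / ?D powr (real d + \<tau>) = 2 powr (d + \<tau>) * (2 * ?D) powr - (d + \<tau>)"
          using le r powr_minus_divide[of "2 * ?D" "d + \<tau>"] by (simp add: powr_mult)
        ultimately show ?thesis by (simp add: mult_left_mono)
      qed
      then show "indicator {y. r \<le> Rn_dist d x y} y * ennreal (1 / Rn_dist d x y powr (real d + \<tau>))
        \<le> ennreal (2 powr (d + \<tau>)) * (\<Prod>i<d. ennreal (?h i (y i)))"
        by (auto simp: indicator_def prod_ennreal ennreal_mult[symmetric] prod_nonneg intro!: ennreal_leI)
    qed
    also have "\<dots> = ennreal (2 powr (d + \<tau>)) * (\<integral>\<^sup>+y. (\<Prod>i<d. ennreal (?h i (y i))) \<partial>Rn_lborel d)"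
      unfolding Rn_lborel_def by (rule nn_integral_cmult) measurable
    also have "(\<integral>\<^sup>+y. (\<Prod>i<d. ennreal (?h i (y i))) \<partial>Rn_lborel d) = (\<Prod>i<d. (\<integral>\<^sup>+t. ennreal (?h i t) \<partial>lborel))"
      unfolding Rn_lborel_def by (rule product_nn_integral_prod) auto
    also have "\<dots> \<le> (\<Prod>i<d. ennreal (2 * r powr - \<sigma> / \<sigma>))"
      using nn_integral_powr_tail_le[OF r \<sigma>(1)] by (intro prod_mono_ennreal) auto
    also have "\<dots> = ennreal ((2 * r powr - \<sigma> / \<sigma>) ^ d)"
      using \<sigma> by (simp add: ennreal_power)
    also have "(2 * r powr - \<sigma> / \<sigma>) ^ d = (2 / \<sigma>) ^ d * r powr - \<tau>"
    proof -
      have "(r powr - \<sigma>) ^ d = r powr - \<tau>"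
        using r \<sigma> by (subst powr_realpow[symmetric]) (auto simp: powr_powr)
      then show ?thesis by (simp add: power_divide power_mult_distrib)
    qed
    also have "ennreal (2 powr (d + \<tau>)) * ennreal ((2 / \<sigma>) ^ d * r powr - \<tau>) = ennreal (C * r powr - \<tau>)"
      using \<sigma> by (simp add: ennreal_mult[symmetric] C_def mult.assoc)
    finally show "(\<integral>\<^sup>+y. indicator {y. r \<le> Rn_dist d x y} y * ennreal (1 / Rn_dist d x y powr (real d + \<tau>)) \<partial>Rn_lborel d)
       \<le> ennreal (C * r powr - \<tau>)" by (simp add: mult_left_mono)
  qed
qed

text \<open>
  Reflecting the coordinates of \<open>a\<close> isolates each component of \<open>v\<close>, since the two values of the
  linear form add up to \<open>2 v\<^sub>n\<close> (all signs changed) or differ by \<open>2 v\<^sub>j a\<^sub>j\<close> (one sign changed).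
\<close>

lemma Rn_norm_powr_le_average:
  fixes \<epsilon> p :: real
  assumes \<epsilon>: "\<epsilon> > 0" and p: "p > 0"
  shows "\<exists>C>0. \<forall>v. ennreal (Rn_norm (Suc n) v powr p) \<le> ennreal C *
    (\<integral>\<^sup>+a. indicator {a. \<forall>i<n. \<bar>a i\<bar> \<le> \<epsilon>} a * ennreal (\<bar>(\<Sum>i<n. v i * a i) + v n\<bar> powr p) \<partial>Rn_lborel n)"
proof -
  interpret product_sigma_finite "\<lambda>_::nat. lborel :: real measure" by (rule product_sigma_finite_lborel)
  let ?P = "Pi\<^sub>M {..<n} (\<lambda>_::nat. lborel :: real measure)"
  define B where "B = {a::nat \<Rightarrow> real. \<forall>i<n. \<bar>a i\<bar> \<le> \<epsilon>}"
  \<comment> \<open>A corner of the cube on which every coordinate of \<open>a\<close> is bounded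
    below, so that a bound on \<open>v j * a j\<close> gives one on \<open>v j\<close>.\<close>
  define Q where "Q = (\<Pi>\<^sub>E i\<in>{..<n}. {\<epsilon>/2..\<epsilon>})"
  have [measurable]: "Q \<in> sets ?P" unfolding Q_def by (intro sets_PiM_I_finite) auto
  have Q: "emeasure ?P Q = ennreal ((\<epsilon>/2) ^ n)"
    unfolding Q_def using \<epsilon> by (subst emeasure_PiM) (auto simp: ennreal_power)
  \<comment> \<open>The minimum treats both cases at once: factor 1 for the last component,
    \<open>(\<epsilon>/2) powr p\<close> for a component that appears multiplied by
    \<open>a j\<close>.\<close>
  define m where "m = min 1 ((\<epsilon>/2) powr p)"
  have m: "m > 0" using \<epsilon> by (simp add: m_def)
  define C where "C = (real (Suc n)) powr p * (2 / (m * (\<epsilon>/2) ^ n))"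
  have C: "C > 0" using m \<epsilon> by (simp add: C_def)
  show ?thesis
  proof (intro exI[of _ C] conjI C allI)
    fix v :: "nat \<Rightarrow> real"
    define L where "L a = (\<Sum>i<n. v i * a i) + v n" for a
    define I where "I = (\<integral>\<^sup>+a. indicator B a * ennreal (\<bar>L a\<bar> powr p) \<partial>?P)"
    have [measurable]: "L \<in> borel_measurable ?P" "Measurable.pred ?P (\<lambda>a. a \<in> B)"
      unfolding L_def B_def by measurable
    define refl where "refl e a = (\<lambda>i\<in>{..<n}. 0 + e i * a i)" for e a :: "nat \<Rightarrow> real"
    have [measurable]: "refl e \<in> measurable ?P ?P" for e
      unfolding refl_def by measurable
    have I_refl: "(\<integral>\<^sup>+a. indicator B a * ennreal (\<bar>L (refl e a)\<bar> powr p) \<partial>?P) = I"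
      if e: "\<And>i. \<bar>e i\<bar> = 1" for e
    proof -
      have "I = (\<Prod>i\<in>{..<n}. ennreal \<bar>e i\<bar>) * (\<integral>\<^sup>+a. indicator B (refl e a) * ennreal (\<bar>L (refl e a)\<bar> powr p) \<partial>?P)"
        unfolding I_def refl_def
      proof (rule nn_integral_PiM_lborel_affine)
        show "e i \<noteq> 0" for i using e[of i] by auto
      qed auto
      moreover have "indicator B (refl e a) = (indicator B a :: ennreal)" for a
        using e by (auto simp: indicator_def B_def refl_def abs_mult)
      ultimately show ?thesis using e by simp
    qed
    \<comment> \<open>The integral over the cube is invariant under sign changes, so a lower bound
      for the sum of the values at \<open>a\<close> and at its reflection, integrated over
      \<open>Q\<close>, bounds twice \<open>I\<close> from below.\<close>
    have comp: "ennreal (\<bar>c\<bar> powr p * m) * ennreal ((\<epsilon>/2) ^ n) \<le> 2 * I"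
      if e: "\<And>i. \<bar>e i\<bar> = 1" and c: "\<And>a. a \<in> Q \<Longrightarrow> \<bar>c\<bar> powr p * m \<le> \<bar>L a\<bar> powr p + \<bar>L (refl e a)\<bar> powr p" for e c
    proof -
      have "ennreal (\<bar>c\<bar> powr p * m) * ennreal ((\<epsilon>/2) ^ n) = (\<integral>\<^sup>+a. ennreal (\<bar>c\<bar> powr p * m) * indicator Q a \<partial>?P)"
        by (simp add: nn_integral_cmult_indicator Q)
      also have "\<dots> \<le> (\<integral>\<^sup>+a. indicator B a * ennreal (\<bar>L a\<bar> powr p) + indicator B a * ennreal (\<bar>L (refl e a)\<bar> powr p) \<partial>?P)"
      proof (rule nn_integral_mono)
        fix a
        have "a \<in> B" if "a \<in> Q"
        proof -
          have "\<epsilon>/2 \<le> a i \<and> a i \<le> \<epsilon>" if "i < n" for i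
            using \<open>a \<in> Q\<close> that by (auto simp: Q_def PiE_iff)
          then show ?thesis using \<epsilon> unfolding B_def by fastforce
        qed
        then show "ennreal (\<bar>c\<bar> powr p * m) * indicator Q a \<le>
          indicator B a * ennreal (\<bar>L a\<bar> powr p) + indicator B a * ennreal (\<bar>L (refl e a)\<bar> powr p)"
          using c[of a] by (auto simp: indicator_def ennreal_plus[symmetric] simp del: ennreal_plus intro!: ennreal_leI)
      qed
      also have "\<dots> = I + (\<integral>\<^sup>+a. indicator B a * ennreal (\<bar>L (refl e a)\<bar> powr p) \<partial>?P)"
        unfolding I_def by (rule nn_integral_add) measurable
      also have "\<dots> = I + I" by (simp add: I_refl[OF e])
      finally show ?thesis by (simp add: mult_2)
    qed
    have max: "\<bar>z\<bar> powr p \<le> \<bar>x\<bar> powr p + \<bar>y\<bar> powr p" if "2 * \<bar>z\<bar> \<le> \<bar>x\<bar> + \<bar>y\<bar>" for x y z :: real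
    proof -
      have "\<bar>z\<bar> \<le> \<bar>x\<bar> \<or> \<bar>z\<bar> \<le> \<bar>y\<bar>" using that by linarith
      then show ?thesis using powr_mono2[of p "\<bar>z\<bar>" "\<bar>x\<bar>"] powr_mono2[of p "\<bar>z\<bar>" "\<bar>y\<bar>"] p
        by (smt (verit) powr_ge_zero)
    qed
    have each: "ennreal (\<bar>v j\<bar> powr p * m) * ennreal ((\<epsilon>/2) ^ n) \<le> 2 * I" if j: "j < Suc n" for j
    proof (cases "j = n")
      case True
      show ?thesis unfolding True
      proof (rule comp[of "\<lambda>_. -1"])
        fix a assume "a \<in> Q"
        have "L a + L (refl (\<lambda>_. -1) a) = 2 * v n"
          by (simp add: L_def refl_def sum_negf)
        then have "\<bar>v n\<bar> powr p \<le> \<bar>L a\<bar> powr p + \<bar>L (refl (\<lambda>_. -1) a)\<bar> powr p" by (intro max) linarith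
        moreover have "\<bar>v n\<bar> powr p * m \<le> \<bar>v n\<bar> powr p" unfolding m_def by (simp add: mult_left_le)
        ultimately show "\<bar>v n\<bar> powr p * m \<le> \<bar>L a\<bar> powr p + \<bar>L (refl (\<lambda>_. -1) a)\<bar> powr p" by linarith
      qed simp
    next
      case False
      then have jn: "j < n" using j by simp
      let ?e = "\<lambda>i. if i = j then -1 else 1 :: real"
      show ?thesis
      proof (rule comp[of ?e])
        fix a assume a: "a \<in> Q"
        have "L a - L (refl ?e a) = (\<Sum>i<n. v i * a i - v i * refl ?e a i)"
          unfolding L_def by (simp add: sum_subtractf)
        also have "\<dots> = (\<Sum>i<n. if i = j then 2 * (v j * a j) else 0)"
          by (intro sum.cong) (auto simp: refl_def)
        finally have "L a - L (refl ?e a) = 2 * (v j * a j)" using jn by simp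
        then have "\<bar>v j * a j\<bar> powr p \<le> \<bar>L a\<bar> powr p + \<bar>L (refl ?e a)\<bar> powr p" by (intro max) linarith
        moreover have "\<bar>v j\<bar> powr p * m \<le> \<bar>v j * a j\<bar> powr p"
        proof -
          have "\<epsilon>/2 \<le> a j" using a jn by (auto simp: Q_def PiE_iff)
          then have "m \<le> \<bar>a j\<bar> powr p" unfolding m_def using \<epsilon> p by (intro min.coboundedI2 powr_mono2) auto
          then show ?thesis by (simp add: abs_mult powr_mult mult_left_mono)
        qed
        ultimately show "\<bar>v j\<bar> powr p * m \<le> \<bar>L a\<bar> powr p + \<bar>L (refl ?e a)\<bar> powr p" by linarith
      qed simp
    qed
    \<comment> \<open>The component of largest modulus controls the norm up to the factor
      \<open>Suc n\<close>.\<close>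
    obtain j where j: "j < Suc n" "\<And>i. i < Suc n \<Longrightarrow> \<bar>v i\<bar> \<le> \<bar>v j\<bar>"
    proof -
      have "Max ((\<lambda>i. \<bar>v i\<bar>) ` {..<Suc n}) \<in> (\<lambda>i. \<bar>v i\<bar>) ` {..<Suc n}" by (intro Max_in) auto
      then obtain j where "j < Suc n" "Max ((\<lambda>i. \<bar>v i\<bar>) ` {..<Suc n}) = \<bar>v j\<bar>" by (metis (no_types, lifting) imageE lessThan_iff)
      moreover have "\<bar>v i\<bar> \<le> Max ((\<lambda>i. \<bar>v i\<bar>) ` {..<Suc n})" if "i < Suc n" for i
        by (rule Max_ge) (use that in \<open>blast | simp\<close>)+
      ultimately show ?thesis using that by metis
    qed
    have "Rn_norm (Suc n) v \<le> (\<Sum>i<Suc n. \<bar>v i\<bar>)" unfolding Rn_norm_def by (rule L2_set_le_sum_abs)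
    also have "\<dots> \<le> (\<Sum>i<Suc n. \<bar>v j\<bar>)" by (rule sum_mono) (use j in auto)
    also have "\<dots> = real (Suc n) * \<bar>v j\<bar>" by (simp only: sum_constant card_lessThan)
    finally have "Rn_norm (Suc n) v powr p \<le> (real (Suc n) * \<bar>v j\<bar>) powr p"
      using p by (intro powr_mono2) auto
    also have "\<dots> = (real (Suc n) powr p / (m * (\<epsilon>/2) ^ n)) * (\<bar>v j\<bar> powr p * m * (\<epsilon>/2) ^ n)"
      using m \<epsilon> by (simp add: powr_mult)
    finally have "ennreal (Rn_norm (Suc n) v powr p) \<le>
       ennreal (real (Suc n) powr p / (m * (\<epsilon>/2) ^ n)) * (ennreal (\<bar>v j\<bar> powr p * m) * ennreal ((\<epsilon>/2) ^ n))"
      using m \<epsilon> by (simp add: ennreal_mult[symmetric] ennreal_leI del: of_nat_Suc)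
    also have "\<dots> \<le> ennreal (real (Suc n) powr p / (m * (\<epsilon>/2) ^ n)) * (2 * I)"
      by (intro mult_left_mono each j) auto
    also have "\<dots> = ennreal (real (Suc n) powr p / (m * (\<epsilon>/2) ^ n) * 2) * I"
      using m \<epsilon> by (subst ennreal_mult) (auto simp: mult.assoc)
    also have "real (Suc n) powr p / (m * (\<epsilon>/2) ^ n) * 2 = C" by (simp add: C_def)
    finally show "ennreal (Rn_norm (Suc n) v powr p) \<le> ennreal C *
      (\<integral>\<^sup>+a. indicator {a. \<forall>i<n. \<bar>a i\<bar> \<le> \<epsilon>} a * ennreal (\<bar>(\<Sum>i<n. v i * a i) + v n\<bar> powr p) \<partial>Rn_lborel n)"
      by (simp add: I_def L_def B_def Rn_lborel_def)
  qed
qed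

text \<open>Along the line \<open>f\<close> has slope at most 1/2 in modulus, so the height grows at
  a rate between 1/2 and 3/2. It therefore has exactly one zero \<open>h\<close>, and beyond
  \<open>h\<close> it is comparable to \<open>t - h\<close>. The line enters the epigraph there and
  never leaves.\<close>

lemma epigraph_on_line:
  assumes lip: "\<And>x y. x \<in> Rn n \<Longrightarrow> y \<in> Rn n \<Longrightarrow> \<bar>f x - f y\<bar> \<le> (\<Sum>i<n. \<bar>x i - y i\<bar>)"
    and a: "(\<Sum>i<n. \<bar>a i\<bar>) \<le> 1/2"
  shows "\<exists>h. \<forall>t. (t - f (\<lambda>i\<in>{..<n}. x i + t * a i) > 0 \<longleftrightarrow> t > h) \<and>
     (t > h \<longrightarrow> t - f (\<lambda>i\<in>{..<n}. x i + t * a i) \<ge> (t - h) / 2 \<and>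
        t - f (\<lambda>i\<in>{..<n}. x i + t * a i) \<le> 2 * (t - h))"
proof -
  define \<phi> where "\<phi> t = t - f (\<lambda>i\<in>{..<n}. x i + t * a i)" for t
  have f: "\<bar>f (\<lambda>i\<in>{..<n}. x i + t * a i) - f (\<lambda>i\<in>{..<n}. x i + s * a i)\<bar> \<le> \<bar>t - s\<bar> / 2" for s t
  proof -
    have "\<bar>f (\<lambda>i\<in>{..<n}. x i + t * a i) - f (\<lambda>i\<in>{..<n}. x i + s * a i)\<bar> \<le> (\<Sum>i<n. \<bar>t - s\<bar> * \<bar>a i\<bar>)"
      by (rule order_trans[OF lip]) (auto simp: Rn_def abs_mult[symmetric] left_diff_distrib)
    also have "\<dots> \<le> \<bar>t - s\<bar> * (1/2)" unfolding sum_distrib_left[symmetric] using a by (intro mult_left_mono) auto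
    finally show ?thesis by simp
  qed
  have lower: "\<phi> t - \<phi> s \<ge> (t - s) / 2" and upper: "\<phi> t - \<phi> s \<le> 2 * (t - s)" if "s \<le> t" for s t
  proof -
    define F where "F t = f (\<lambda>i\<in>{..<n}. x i + t * a i)" for t
    have "\<phi> t - \<phi> s = t - s - (F t - F s)" "\<bar>F t - F s\<bar> \<le> (t - s) / 2"
      using f[of t s] that by (auto simp: \<phi>_def F_def)
    note * = this(1) abs_le_D1[OF this(2)] abs_le_D2[OF this(2)]
    show "\<phi> t - \<phi> s \<ge> (t - s) / 2" using *(1,2) by (simp add: field_simps)
    show "\<phi> t - \<phi> s \<le> 2 * (t - s)" using *(1,3) that by (simp add: field_simps)
  qed
  have le: "0 \<le> \<phi> t - \<phi> s" if "s \<le> t" for s t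
    using lower[OF that] that by (meson diff_ge_0_iff_ge divide_nonneg_pos order_trans zero_less_numeral)
  have \<phi>_lip: "\<bar>\<phi> s - \<phi> t\<bar> \<le> 2 * \<bar>s - t\<bar>" for s t
  proof (cases "s \<le> t")
    case True then show ?thesis using le[OF True] upper[OF True] by simp
  next
    case False then show ?thesis using le[of t s] upper[of t s] by simp
  qed
  have cont: "isCont \<phi> t" for t
    unfolding continuous_at_eps_delta dist_real_def
  proof (intro allI impI)
    fix e :: real assume e: "e > 0"
    have "\<bar>\<phi> s - \<phi> t\<bar> < e" if "\<bar>s - t\<bar> < e / 2" for s
      using \<phi>_lip[of s t] that by (simp add: field_simps)
    then show "\<exists>d>0. \<forall>s. \<bar>s - t\<bar> < d \<longrightarrow> \<bar>\<phi> s - \<phi> t\<bar> < e"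
      using e by (intro exI[of _ "e/2"]) auto
  qed
  \<comment> \<open>Growth at rate at least 1/2 over a parameter interval of length
    \<open>?T\<close> outweighs the value at 0, which gives the signs for the intermediate value
    theorem.\<close>
  let ?T = "2 * \<bar>\<phi> 0\<bar>"
  have "\<phi> (- ?T) \<le> 0" using lower[of "- ?T" 0] by simp
  moreover have "0 \<le> \<phi> ?T" using lower[of 0 ?T] by simp
  ultimately have "\<exists>h. - ?T \<le> h \<and> h \<le> ?T \<and> \<phi> h = 0"
    using cont by (intro IVT) auto
  then obtain h where h: "\<phi> h = 0" by blast
  have "(\<phi> t > 0 \<longleftrightarrow> t > h) \<and> (t > h \<longrightarrow> \<phi> t \<ge> (t - h) / 2 \<and> \<phi> t \<le> 2 * (t - h))" for t
  proof (cases "t > h")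
    case True
    then show ?thesis using lower[of h t] upper[of h t] h by simp
  next
    case False
    then show ?thesis using lower[of t h] h by simp
  qed
  then show ?thesis unfolding \<phi>_def by blast
qed


section \<open>Integration along parallel lines\<close>

interpretation Rn_lborel: sigma_finite_measure "Rn_lborel d" for d
  unfolding Rn_lborel_def
  by (rule product_sigma_finite.sigma_finite[OF product_sigma_finite_lborel]) simp

interpretation Rn_lborel_pair: pair_sigma_finite "Rn_lborel d" "Rn_lborel e" for d e ..

interpretation Rn_lborel_lborel_pair: pair_sigma_finite "Rn_lborel d" "lborel :: real measure" for d ..

interpretation lborel_Rn_lborel_pair: pair_sigma_finite "lborel :: real measure" "Rn_lborel d" for d ..

lemma measurable_Rn_lborel [measurable (raw)]:
  assumes "\<And>i. i < d \<Longrightarrow> (\<lambda>x. f x i) \<in> borel_measurable N"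
  shows "(\<lambda>x. \<lambda>i\<in>{..<d}. f x i) \<in> measurable N (Rn_lborel d)"
  unfolding Rn_lborel_def using assms by (intro measurable_restrict) auto

lemma measurable_Rn_component:
  assumes "g \<in> measurable N (Rn_lborel d)" "i < d"
  shows "(\<lambda>x. g x i) \<in> borel_measurable N"
  using measurable_compose[OF assms(1)[unfolded Rn_lborel_def] measurable_component_singleton, of i] assms(2)
  by simp

lemma measurable_Rn_fun_upd [measurable (raw)]:
  assumes "g \<in> measurable N (Rn_lborel n)" "h \<in> borel_measurable N"
  shows "(\<lambda>x. (g x)(n := h x)) \<in> measurable N (Rn_lborel (Suc n))"
  unfolding Rn_lborel_def using assms unfolding Rn_lborel_def
  by (intro measurable_fun_upd[where J="{..<n}"]) auto

text \<open>The line through \<open>(x, 0)\<close> in direction \<open>(a, 1)\<close>. Using the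
  last coordinate as parameter, rather than arc length, makes the passage to these coordinates a
  shear and lets directions carry plain Lebesgue measure.\<close>

definition line_point :: "nat \<Rightarrow> (nat \<Rightarrow> real) \<Rightarrow> (nat \<Rightarrow> real) \<Rightarrow> real \<Rightarrow> nat \<Rightarrow> real" where
  "line_point n a x t = (\<lambda>i\<in>{..<Suc n}. if i < n then x i + t * a i else t)"

lemma measurable_line_point [measurable (raw)]:
  assumes [measurable]: "a \<in> measurable N (Rn_lborel n)" "x \<in> measurable N (Rn_lborel n)" "t \<in> borel_measurable N"
  shows "(\<lambda>w. line_point n (a w) (x w) (t w)) \<in> measurable N (Rn_lborel (Suc n))"
  unfolding line_point_def
proof (rule measurable_Rn_lborel)
  fix i
  show "(\<lambda>w. if i < n then x w i + t w * a w i else t w) \<in> borel_measurable N"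
    using measurable_Rn_component [measurable (raw)] by (cases "i < n") auto
qed

lemma nn_integral_Rn_affine:
  assumes "F \<in> borel_measurable (Rn_lborel n)" "b \<noteq> 0"
  shows "(\<integral>\<^sup>+x. F x \<partial>Rn_lborel n) = ennreal \<bar>b\<bar> ^ n * (\<integral>\<^sup>+x. F (\<lambda>i\<in>{..<n}. c i + b * x i) \<partial>Rn_lborel n)"
  unfolding Rn_lborel_def
  by (subst nn_integral_PiM_lborel_affine[where b="\<lambda>_. b" and c=c]) (use assms in \<open>auto simp: Rn_lborel_def\<close>)

lemma nn_integral_Rn_Suc:
  assumes "F \<in> borel_measurable (Rn_lborel (Suc n))"
  shows "(\<integral>\<^sup>+x. F x \<partial>Rn_lborel (Suc n)) = (\<integral>\<^sup>+t. \<integral>\<^sup>+x. F (x(n := t)) \<partial>Rn_lborel n \<partial>lborel)"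
proof -
  interpret product_sigma_finite "\<lambda>_::nat. lborel :: real measure" by (rule product_sigma_finite_lborel)
  show ?thesis using assms product_nn_integral_insert_rev[of "{..<n}" n F]
    unfolding Rn_lborel_def lessThan_Suc by simp
qed

text \<open>At each fixed height \<open>t\<close> the horizontal coordinates are merely translated
  by \<open>t * a\<close>, so the shear preserves Lebesgue measure.\<close>

lemma nn_integral_Rn_lines:
  assumes [measurable]: "F \<in> borel_measurable (Rn_lborel (Suc n))" "a \<in> space (Rn_lborel n)"
  shows "(\<integral>\<^sup>+x. F x \<partial>Rn_lborel (Suc n)) = (\<integral>\<^sup>+x. \<integral>\<^sup>+t. F (line_point n a x t) \<partial>lborel \<partial>Rn_lborel n)"
proof -
  have "(\<integral>\<^sup>+x. F (x(n := t)) \<partial>Rn_lborel n) = (\<integral>\<^sup>+x. F (line_point n a x t) \<partial>Rn_lborel n)" for t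
  proof -
    have "(\<lambda>i\<in>{..<n}. t * a i + 1 * x i)(n := t) = line_point n a x t" for x
      by (auto simp: line_point_def fun_eq_iff)
    then show ?thesis
      by (subst nn_integral_Rn_affine[where b=1 and c="\<lambda>i. t * a i"]) auto
  qed
  then have "(\<integral>\<^sup>+x. F x \<partial>Rn_lborel (Suc n)) = (\<integral>\<^sup>+t. \<integral>\<^sup>+x. F (line_point n a x t) \<partial>Rn_lborel n \<partial>lborel)"
    by (simp add: nn_integral_Rn_Suc)
  also have "\<dots> = (\<integral>\<^sup>+x. \<integral>\<^sup>+t. F (line_point n a x t) \<partial>lborel \<partial>Rn_lborel n)"
    by (rule Rn_lborel_lborel_pair.Fubini') measurable
  finally show ?thesis .
qed

text \<open>
  For fixed end heights \<open>t \<noteq> t'\<close> the second point has horizontal part \<open>x + (t' - t) a\<close> relative to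
  the first, so the direction \<open>a\<close> parametrises it with Jacobian \<open>\<bar>t' - t\<bar> ^ n\<close>.
\<close>

lemma nn_integral_lines_le_double_integral:
  assumes n: "n > 0" and [measurable]: "F \<in> borel_measurable (Rn_lborel (Suc n) \<Otimes>\<^sub>M Rn_lborel (Suc n))"
  shows "(\<integral>\<^sup>+a. \<integral>\<^sup>+x. \<integral>\<^sup>+t. \<integral>\<^sup>+t'. ennreal \<bar>t' - t\<bar> ^ n * F (line_point n a x t, line_point n a x t')
            \<partial>lborel \<partial>lborel \<partial>Rn_lborel n \<partial>Rn_lborel n)
         \<le> (\<integral>\<^sup>+x. \<integral>\<^sup>+y. F (x, y) \<partial>Rn_lborel (Suc n) \<partial>Rn_lborel (Suc n))"
proof -
  note measurable_Rn_component [measurable (raw)]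
  let ?R = "Rn_lborel n"
  let ?H = "\<lambda>a x t t'. ennreal \<bar>t' - t\<bar> ^ n * F (line_point n a x t, line_point n a x t')"
  let ?s = "\<lambda>a x t t'. (\<lambda>i\<in>{..<n}. x i + (t' - t) * a i)(n := t')"
  let ?K = "\<lambda>a x t t'. ennreal \<bar>t' - t\<bar> ^ n * F (x(n := t), ?s a x t t')"
  \<comment> \<open>Translating by \<open>- t * a\<close> frees the first point from the direction:
    it becomes \<open>x\<close> at height \<open>t\<close>, and only the second point still depends
    on \<open>a\<close>.\<close>
  have shift: "(\<integral>\<^sup>+x. ?H a x t t' \<partial>?R) = (\<integral>\<^sup>+x. ?K a x t t' \<partial>?R)" if [measurable]: "a \<in> space ?R" for a t t'
  proof -
    have eq: "line_point n a (\<lambda>i\<in>{..<n}. - t * a i + 1 * x i) t = x(n := t)"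
         "line_point n a (\<lambda>i\<in>{..<n}. - t * a i + 1 * x i) t' = ?s a x t t'" if "x \<in> space ?R" for x
      using that by (auto simp: line_point_def fun_eq_iff space_Rn_lborel Rn_def PiE_iff extensional_def algebra_simps)
    have "(\<integral>\<^sup>+x. ?H a x t t' \<partial>?R) = (\<integral>\<^sup>+x. ?H a (\<lambda>i\<in>{..<n}. - t * a i + 1 * x i) t t' \<partial>?R)"
      by (subst nn_integral_Rn_affine[where b=1 and c="\<lambda>i. - t * a i"]) auto
    also have "\<dots> = (\<integral>\<^sup>+x. ?K a x t t' \<partial>?R)"
      by (intro nn_integral_cong) (simp only: eq)
    finally show ?thesis .
  qed
  \<comment> \<open>For distinct heights this is the substitution
    \<open>y = x + (t' - t) * a\<close>, and equality holds. For equal heights the left side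
    vanishes because \<open>0 ^ n = 0\<close> for positive \<open>n\<close>; the inequality covers
    both cases.\<close>
  have inner: "(\<integral>\<^sup>+a. ?K a x t t' \<partial>?R) \<le> (\<integral>\<^sup>+y. F (x(n := t), y(n := t')) \<partial>?R)"
    if [measurable]: "x \<in> space ?R" for x t t'
  proof (cases "t = t'")
    case True
    then show ?thesis using n by (simp add: zero_power)
  next
    case False
    have "(\<integral>\<^sup>+y. F (x(n := t), y(n := t')) \<partial>?R) = ennreal \<bar>t' - t\<bar> ^ n * (\<integral>\<^sup>+a. F (x(n := t), ?s a x t t') \<partial>?R)"
      using False by (subst nn_integral_Rn_affine[where b="t' - t" and c=x]) auto
    also have "\<dots> = (\<integral>\<^sup>+a. ?K a x t t' \<partial>?R)"
      by (rule nn_integral_cmult[symmetric]) measurable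
    finally show ?thesis by simp
  qed
  \<comment> \<open>The interchanges first bring \<open>x\<close> innermost for the translation,
    then \<open>a\<close> innermost for the substitution, and finally regroup horizontal parts and
    heights into points.\<close>
  have "(\<integral>\<^sup>+a. \<integral>\<^sup>+x. \<integral>\<^sup>+t. \<integral>\<^sup>+t'. ?H a x t t' \<partial>lborel \<partial>lborel \<partial>?R \<partial>?R)
     = (\<integral>\<^sup>+a. \<integral>\<^sup>+t. \<integral>\<^sup>+x. \<integral>\<^sup>+t'. ?H a x t t' \<partial>lborel \<partial>?R \<partial>lborel \<partial>?R)"
    by (intro nn_integral_cong lborel_Rn_lborel_pair.Fubini') measurable
  also have "\<dots> = (\<integral>\<^sup>+a. \<integral>\<^sup>+t. \<integral>\<^sup>+t'. \<integral>\<^sup>+x. ?H a x t t' \<partial>?R \<partial>lborel \<partial>lborel \<partial>?R)"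
    by (intro nn_integral_cong lborel_Rn_lborel_pair.Fubini') measurable
  also have "\<dots> = (\<integral>\<^sup>+a. \<integral>\<^sup>+t. \<integral>\<^sup>+t'. \<integral>\<^sup>+x. ?K a x t t' \<partial>?R \<partial>lborel \<partial>lborel \<partial>?R)"
    by (intro nn_integral_cong shift)
  also have "\<dots> = (\<integral>\<^sup>+t. \<integral>\<^sup>+a. \<integral>\<^sup>+t'. \<integral>\<^sup>+x. ?K a x t t' \<partial>?R \<partial>lborel \<partial>?R \<partial>lborel)"
    by (rule lborel_Rn_lborel_pair.Fubini') measurable
  also have "\<dots> = (\<integral>\<^sup>+t. \<integral>\<^sup>+t'. \<integral>\<^sup>+a. \<integral>\<^sup>+x. ?K a x t t' \<partial>?R \<partial>?R \<partial>lborel \<partial>lborel)"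
    by (intro nn_integral_cong lborel_Rn_lborel_pair.Fubini') measurable
  also have "\<dots> = (\<integral>\<^sup>+t. \<integral>\<^sup>+t'. \<integral>\<^sup>+x. \<integral>\<^sup>+a. ?K a x t t' \<partial>?R \<partial>?R \<partial>lborel \<partial>lborel)"
    by (intro nn_integral_cong Rn_lborel_pair.Fubini') measurable
  also have "\<dots> \<le> (\<integral>\<^sup>+t. \<integral>\<^sup>+t'. \<integral>\<^sup>+x. \<integral>\<^sup>+y. F (x(n := t), y(n := t')) \<partial>?R \<partial>?R \<partial>lborel \<partial>lborel)"
    by (intro nn_integral_mono inner)
  also have "\<dots> = (\<integral>\<^sup>+t. \<integral>\<^sup>+x. \<integral>\<^sup>+t'. \<integral>\<^sup>+y. F (x(n := t), y(n := t')) \<partial>?R \<partial>lborel \<partial>?R \<partial>lborel)"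
    by (intro nn_integral_cong Rn_lborel_lborel_pair.Fubini') measurable
  also have "\<dots> = (\<integral>\<^sup>+t. \<integral>\<^sup>+x. \<integral>\<^sup>+y. F (x(n := t), y) \<partial>Rn_lborel (Suc n) \<partial>?R \<partial>lborel)"
    by (intro nn_integral_cong nn_integral_Rn_Suc[symmetric]) measurable
  also have "\<dots> = (\<integral>\<^sup>+x. \<integral>\<^sup>+y. F (x, y) \<partial>Rn_lborel (Suc n) \<partial>Rn_lborel (Suc n))"
    by (rule nn_integral_Rn_Suc[symmetric]) measurable
  finally show ?thesis .
qed


section \<open>Epigraphs and extension by zero\<close>

lemma openin_Rn_top_imp_subset: "openin (Rn_top d) V \<Longrightarrow> V \<subseteq> Rn d"
  using openin_subset[of "Rn_top d" V] by (simp add: topspace_Rn_top)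

lemma emeasure_Rn_box_pos:
  assumes "e > 0"
  shows "emeasure (Rn_lborel d) (\<Pi>\<^sub>E i\<in>{..<d}. {x i - e<..<x i + e}) > 0"
proof -
  interpret product_sigma_finite "\<lambda>_::nat. lborel :: real measure" by (rule product_sigma_finite_lborel)
  have "emeasure (Rn_lborel d) (\<Pi>\<^sub>E i\<in>{..<d}. {x i - e<..<x i + e}) = ennreal ((2 * e) ^ d)"
    unfolding Rn_lborel_def using assms by (subst emeasure_PiM) (auto simp: ennreal_power)
  then show ?thesis using assms by simp
qed

text \<open>A strict violation at one point would persist on a small box, and a box has positive
  measure. This turns the essential supremum in the Lipschitz constant into a pointwise
  bound.\<close>

lemma continuous_on_Rn_AE_le:
  assumes cont: "continuous_map (Rn_top d) euclideanreal g" and AE: "AE x in Rn_lborel d. g x \<le> c"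
    and x: "x \<in> Rn d"
  shows "g x \<le> c"
proof (rule ccontr)
  assume "\<not> g x \<le> c"
  have "openin (Rn_top d) {y \<in> topspace (Rn_top d). g y \<in> {c<..}}"
    using cont by (intro openin_continuous_map_preimage) auto
  then obtain e where e: "e > 0" "\<And>y. y \<in> Rn d \<Longrightarrow> (\<forall>i<d. \<bar>y i - x i\<bar> < e) \<Longrightarrow> g y > c"
    using x \<open>\<not> g x \<le> c\<close> unfolding openin_Rn_top_iff by (auto simp: topspace_Rn_top)
  let ?B = "\<Pi>\<^sub>E i\<in>{..<d}. {x i - e<..<x i + e}"
  have "AE y in Rn_lborel d. y \<notin> ?B"
    using AE
  proof eventually_elim
    case (elim y)
    show ?case
    proof
      assume y: "y \<in> ?B"
      then have "x i - e < y i \<and> y i < x i + e" if "i < d" for i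
        using that by (auto simp: PiE_iff)
      then have "\<forall>i<d. \<bar>y i - x i\<bar> < e" by (simp add: abs_less_iff algebra_simps)
      moreover have "y \<in> Rn d" using y by (auto simp: Rn_def PiE_iff)
      ultimately show False using e(2) elim by fastforce
    qed
  qed
  moreover have "?B \<in> sets (Rn_lborel d)" unfolding Rn_lborel_def by (intro sets_PiM_I_finite) auto
  moreover have "?B \<subseteq> space (Rn_lborel d)"
    unfolding space_Rn_lborel Rn_def by (rule PiE_mono) simp
  then have "{y \<in> space (Rn_lborel d). \<not> y \<notin> ?B} = ?B" by blast
  ultimately have "emeasure (Rn_lborel d) ?B = 0"
    using AE_iff_measurable[of ?B "Rn_lborel d" "\<lambda>y. y \<notin> ?B"] by simp
  then show False using emeasure_Rn_box_pos[OF e(1), of d x] by simp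
qed

lemma openin_Rn: "openin (Rn_top d) (Rn d)"
  using openin_topspace[of "Rn_top d"] by (simp add: topspace_Rn_top)

lemma subtopology_Rn: "subtopology (Rn_top d) (Rn d) = Rn_top d"
  by (metis subtopology_topspace topspace_Rn_top)

text \<open>The gradient bound passes from almost everywhere to everywhere one partial derivative at
  a time, and the staircase estimate then gives the l1 form. That form fits directions whose l1 norm
  is bounded, with no constant depending on \<open>n\<close>.\<close>

lemma supporting_function_lipschitz:
  assumes f: "supporting_function (Suc n) f" and M: "epigraph_lipschitz_const (Suc n) f < 1"
    and x: "x \<in> Rn n" and y: "y \<in> Rn n"
  shows "\<bar>f x - f y\<bar> \<le> (\<Sum>i<n. \<bar>x i - y i\<bar>)"
proof -
  have C1: "C1_on n (Rn n) f" using f by (simp add: supporting_function_def)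
  have AE: "AE x in Rn_lborel n. Rn_norm n (gradient n f x) \<le> 1"
    using esssup_AE[of "\<lambda>x. ennreal (Rn_norm n (gradient n f x))" "Rn_lborel n"]
  proof eventually_elim
    case (elim x)
    then have "ennreal (Rn_norm n (gradient n f x)) < 1"
      using M unfolding epigraph_lipschitz_const_def diff_Suc_1 by (rule le_less_trans)
    then show ?case by (simp add: ennreal_less_one_iff)
  qed
  have bound: "\<bar>partial_deriv i f z\<bar> \<le> 1" if i: "i < n" and z: "z \<in> Rn n" for i z
  proof (rule continuous_on_Rn_AE_le[where g="\<lambda>x. \<bar>partial_deriv i f x\<bar>", OF _ _ z])
    show "continuous_map (Rn_top n) euclideanreal (\<lambda>x. \<bar>partial_deriv i f x\<bar>)"
      using C1 i by (intro continuous_intros) (auto simp: C1_on_def subtopology_Rn)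
    show "AE x in Rn_lborel n. \<bar>partial_deriv i f x\<bar> \<le> 1"
      using AE
    proof eventually_elim
      case (elim x)
      have "\<bar>gradient n f x i\<bar> \<le> Rn_norm n (gradient n f x)"
        unfolding Rn_norm_def using member_le_L2_set[of "{..<n}" i "\<lambda>i. \<bar>gradient n f x i\<bar>"] i
        by (simp add: L2_set_def)
      then show ?case using elim i by (simp add: gradient_def)
    qed
  qed
  have "\<bar>f x - f y\<bar> \<le> 1 * (\<Sum>i<n. \<bar>x i - y i\<bar>)"
  proof (rule partial_deriv_mean_value[OF y x])
    show "(\<lambda>t. f (z(i := t))) differentiable at (z i)" if "i < n" "z \<in> Rn n" for i z
      using C1 that unfolding C1_on_def by blast
  qed (rule bound)
  then show ?thesis by simp
qed

text \<open>The weight written \<rho> in the overview: the vertical gap above the graph. Divided by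
  the dimension it is a lower bound for the distance to the complement of the epigraph when
  \<open>f\<close> is l1-Lipschitz with constant 1.\<close>

definition height :: "nat \<Rightarrow> ((nat \<Rightarrow> real) \<Rightarrow> real) \<Rightarrow> (nat \<Rightarrow> real) \<Rightarrow> real" where
  "height n f x = x n - f (restrict x {..<n})"

lemma epigraph_domain_Suc: "epigraph_domain (Suc n) f = {x \<in> Rn (Suc n). height n f x > 0}"
  by (simp add: epigraph_domain_def height_def)

context
  fixes n :: nat and f :: "(nat \<Rightarrow> real) \<Rightarrow> real"
  assumes lip: "\<And>x y. x \<in> Rn n \<Longrightarrow> y \<in> Rn n \<Longrightarrow> \<bar>f x - f y\<bar> \<le> (\<Sum>i<n. \<bar>x i - y i\<bar>)"
begin

lemma height_lipschitz: "\<bar>height n f x - height n f y\<bar> \<le> (\<Sum>i<Suc n. \<bar>x i - y i\<bar>)"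
proof -
  have "\<bar>f (restrict x {..<n}) - f (restrict y {..<n})\<bar> \<le> (\<Sum>i<n. \<bar>x i - y i\<bar>)"
    by (rule order_trans[OF lip]) (auto simp: Rn_def)
  then show ?thesis unfolding height_def by simp
qed

lemma continuous_map_height: "continuous_map (Rn_top (Suc n)) euclideanreal (height n f)"
proof -
  have "\<exists>r>0. \<forall>y\<in>Rn (Suc n). (\<forall>i<Suc n. \<bar>y i - x i\<bar> < r) \<longrightarrow> \<bar>height n f y - height n f x\<bar> < e"
    if e: "e > 0" for x e
  proof (intro exI[of _ "e / Suc n"] conjI ballI impI)
    fix y assume y: "\<forall>i<Suc n. \<bar>y i - x i\<bar> < e / real (Suc n)"
    have "\<bar>height n f y - height n f x\<bar> \<le> (\<Sum>i<Suc n. \<bar>y i - x i\<bar>)" by (rule height_lipschitz)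
    also have "\<dots> < (\<Sum>i<Suc n. e / real (Suc n))" using y by (intro sum_strict_mono) auto
    also have "\<dots> = e" by simp
    finally show "\<bar>height n f y - height n f x\<bar> < e" .
  qed (use e in auto)
  then show ?thesis
    using continuous_map_Rn_iff[OF openin_Rn, of "Suc n"] by (simp only: subtopology_Rn) blast
qed

lemma openin_epigraph_domain: "openin (Rn_top (Suc n)) (epigraph_domain (Suc n) f)"
  using openin_continuous_map_preimage[OF continuous_map_height, of "{0<..}"]
  by (simp add: epigraph_domain_Suc topspace_Rn_top)

lemma measurable_height: "height n f \<in> borel_measurable (Rn_lborel (Suc n))"
  by (rule continuous_imp_borel_measurable_Rn[OF continuous_map_height])

end

section \<open>Regularity of the extension by zero\<close>

definition zero_extension ::
  "nat \<Rightarrow> (nat \<Rightarrow> real) set \<Rightarrow> ((nat \<Rightarrow> real) \<Rightarrow> (nat \<Rightarrow> real)) \<Rightarrow> (nat \<Rightarrow> real) \<Rightarrow> (nat \<Rightarrow> real)" where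
  "zero_extension d D u = (\<lambda>x\<in>Rn d. if x \<in> D then u x else Rn_zero d)"

lemma Rn_zero_in_Rn [simp]: "Rn_zero d \<in> Rn d"
  by (simp add: Rn_zero_def Rn_def)

lemma partial_deriv_cong_on_open:
  assumes W: "openin (Rn_top d) W" and eq: "\<And>y. y \<in> W \<Longrightarrow> g y = h y" and x: "x \<in> W" and i: "i < d"
  shows "(\<lambda>t. g (x(i := t))) differentiable (at (x i)) \<longleftrightarrow> (\<lambda>t. h (x(i := t))) differentiable (at (x i))"
    and "partial_deriv i g x = partial_deriv i h x"
proof -
  obtain e where e: "e > 0" "\<And>y. y \<in> Rn d \<Longrightarrow> (\<forall>i<d. \<bar>y i - x i\<bar> < e) \<Longrightarrow> y \<in> W"
    and xR: "x \<in> Rn d"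
    using W x unfolding openin_Rn_top_iff by blast
  have "g (x(i := t)) = h (x(i := t))" if "\<bar>t - x i\<bar> < e" for t
    using that xR i e by (intro eq e(2) Rn_fun_upd) auto
  then have ev: "\<forall>\<^sub>F t in nhds (x i). g (x(i := t)) = h (x(i := t))"
    unfolding eventually_nhds_metric dist_real_def using e(1) by blast
  show "(\<lambda>t. g (x(i := t))) differentiable (at (x i)) \<longleftrightarrow> (\<lambda>t. h (x(i := t))) differentiable (at (x i))"
    unfolding real_differentiable_def using DERIV_cong_ev[OF refl ev refl] by simp
  show "partial_deriv i g x = partial_deriv i h x"
    unfolding partial_deriv_def by (rule deriv_cong_ev[OF ev refl])
qed

text \<open>Differentiability along a coordinate and continuity of the partials are both local, so
  they may be checked on the two sets of an open cover.\<close>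

lemma C1_on_local:
  assumes UV: "openin (Rn_top d) U" "openin (Rn_top d) V" "U \<union> V = Rn d"
    and g: "C1_on d U g" "C1_on d V g"
  shows "C1_on d (Rn d) g"
  unfolding C1_on_def
proof (intro allI impI conjI ballI)
  fix i assume i: "i < d"
  show "(\<lambda>t. g (x(i := t))) differentiable (at (x i))" if "x \<in> Rn d" for x
    using that UV(3) g i unfolding C1_on_def by blast
  have "\<exists>r>0. \<forall>y\<in>Rn d. (\<forall>j<d. \<bar>y j - x j\<bar> < r) \<longrightarrow> \<bar>partial_deriv i g y - partial_deriv i g x\<bar> < e"
    if x: "x \<in> W" and e: "e > 0" and W: "openin (Rn_top d) W" "C1_on d W g" for W x e
  proof -
    obtain r1 where r1: "r1 > 0" "\<And>y. y \<in> Rn d \<Longrightarrow> (\<forall>i<d. \<bar>y i - x i\<bar> < r1) \<Longrightarrow> y \<in> W"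
      using W(1) x unfolding openin_Rn_top_iff by blast
    have "continuous_map (subtopology (Rn_top d) W) euclideanreal (partial_deriv i g)"
      using W(2) i by (simp add: C1_on_def)
    then obtain r2 where r2: "r2 > 0" "\<And>y. y \<in> W \<Longrightarrow> (\<forall>i<d. \<bar>y i - x i\<bar> < r2) \<Longrightarrow>
        \<bar>partial_deriv i g y - partial_deriv i g x\<bar> < e"
      unfolding continuous_map_Rn_iff[OF W(1)] using x e by meson
    show ?thesis using r1 r2 by (intro exI[of _ "min r1 r2"]) auto
  qed
  note * = this
  show "continuous_map (subtopology (Rn_top d) (Rn d)) euclideanreal (partial_deriv i g)"
    unfolding continuous_map_Rn_iff[OF openin_Rn] proof (intro ballI allI impI)
    fix x and e :: real assume "x \<in> Rn d" "e > 0"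
    then show "\<exists>r>0. \<forall>y\<in>Rn d. (\<forall>j<d. \<bar>y j - x j\<bar> < r) \<longrightarrow> \<bar>partial_deriv i g y - partial_deriv i g x\<bar> < e"
      using * [of x U e] * [of x V e] UV g by blast
  qed
qed

lemma C1_on_cong:
  assumes W: "openin (Rn_top d) W" and eq: "\<And>y. y \<in> W \<Longrightarrow> g y = h y" and g: "C1_on d W g"
  shows "C1_on d W h"
  unfolding C1_on_def
proof (intro allI impI conjI ballI)
  fix i assume i: "i < d"
  show "(\<lambda>t. h (x(i := t))) differentiable (at (x i))" if x: "x \<in> W" for x
  proof -
    have "(\<lambda>t. g (x(i := t))) differentiable (at (x i))" using g i x unfolding C1_on_def by blast
    then show ?thesis using partial_deriv_cong_on_open(1)[of d W g h x i] W eq x i by blast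
  qed
  show "continuous_map (subtopology (Rn_top d) W) euclideanreal (partial_deriv i h)"
  proof (rule continuous_map_eq)
    show "continuous_map (subtopology (Rn_top d) W) euclideanreal (partial_deriv i g)"
      using g i unfolding C1_on_def by blast
    show "partial_deriv i g x = partial_deriv i h x" if "x \<in> topspace (subtopology (Rn_top d) W)" for x
      using that partial_deriv_cong_on_open(2)[of d W g h x i] W eq i by simp
  qed
qed

lemma C1_on_const: "C1_on d W (\<lambda>_. c)"
  unfolding C1_on_def partial_deriv_def by simp

lemma field_support_zero_extension:
  assumes "D \<subseteq> Rn d"
  shows "field_support d (Rn d) (zero_extension d D u) = field_support d D u"
proof -
  have "{x \<in> Rn d. zero_extension d D u x \<noteq> Rn_zero d} = {x \<in> D. u x \<noteq> Rn_zero d}"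
    using assms by (auto simp: zero_extension_def)
  then show ?thesis by (simp add: field_support_def)
qed

lemma field_nonzero_in_support:
  assumes "D \<subseteq> Rn d" "x \<in> D" "u x \<noteq> Rn_zero d"
  shows "x \<in> field_support d D u"
proof -
  have "{x \<in> D. u x \<noteq> Rn_zero d} \<subseteq> field_support d D u"
    unfolding field_support_def by (rule closure_of_subset) (use assms in \<open>auto simp: topspace_Rn_top\<close>)
  then show ?thesis using assms by blast
qed

text \<open>\<open>D\<close> and the complement of the support form an open cover precisely because
  the closed support lies inside \<open>D\<close>. On the first set the extension is
  \<open>u\<close>, on the second it is zero.\<close>

lemma zero_extension_C1c:
  assumes D: "openin (Rn_top d) D" and u: "u \<in> C1c_fields d D"
  shows "zero_extension d D u \<in> C1c_fields d (Rn d)"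
proof -
  have sub: "D \<subseteq> Rn d" using D by (rule openin_Rn_top_imp_subset)
  let ?w = "zero_extension d D u"
  define V where "V = Rn d - field_support d D u"
  have supp: "field_support d D u \<subseteq> D" using u by (simp add: C1c_fields_def)
  have V: "openin (Rn_top d) V"
    unfolding V_def field_support_def topspace_Rn_top[symmetric]
    by (rule openin_diff[OF openin_topspace closedin_closure_of])
  have w0: "?w x = Rn_zero d" if "x \<in> V" for x
    using that field_nonzero_in_support[OF sub] by (auto simp: V_def zero_extension_def)
  have "C1_on d (Rn d) (\<lambda>x. ?w x j)" if j: "j < d" for j
  proof (rule C1_on_local[OF D V])
    show "D \<union> V = Rn d" using sub supp by (auto simp: V_def)
    show "C1_on d D (\<lambda>x. ?w x j)"
    proof (rule C1_on_cong[OF D])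
      show "C1_on d D (\<lambda>x. u x j)" using u j by (simp add: C1c_fields_def)
    qed (use sub in \<open>auto simp: zero_extension_def\<close>)
    show "C1_on d V (\<lambda>x. ?w x j)"
      by (rule C1_on_cong[OF V _ C1_on_const[where c="Rn_zero d j"]]) (simp add: w0)
  qed
  moreover have "?w \<in> Rn d \<rightarrow>\<^sub>E Rn d"
    using u by (auto simp: zero_extension_def C1c_fields_def)
  moreover have "field_support d D u \<subseteq> Rn d" using supp sub by blast
  ultimately show ?thesis
    using u by (simp add: C1c_fields_def field_support_zero_extension[OF sub])
qed

lemma extension_operator_zero_extension:
  assumes D: "openin (Rn_top d) D"
  shows "extension_operator d D (zero_extension d D)"
proof -
  have sub: "D \<subseteq> Rn d" using D by (rule openin_Rn_top_imp_subset)
  have "zero_extension d D (field_lincomb d D a u b v) =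
      field_lincomb d (Rn d) a (zero_extension d D u) b (zero_extension d D v)" for a b u v
    by (rule ext) (use sub in \<open>auto simp: zero_extension_def field_lincomb_def Rn_zero_def\<close>)
  then show ?thesis
    unfolding extension_operator_def using zero_extension_C1c[OF D] sub
    by (auto simp: zero_extension_def)
qed

section \<open>Uniform bounds from compact support\<close>

lemma C1c_fields_continuous:
  assumes "u \<in> C1c_fields d (Rn d)" "j < d"
  shows "continuous_map (Rn_top d) euclideanreal (\<lambda>x. u x j)"
  using C1_on_imp_continuous[OF openin_Rn, of d "\<lambda>x. u x j"] assms
  by (simp add: C1c_fields_def subtopology_Rn)

lemma compactin_Rn_bounded_image:
  assumes "compactin (Rn_top d) S" "continuous_map (Rn_top d) euclideanreal g"
  shows "\<exists>K. \<forall>x\<in>S. \<bar>g x\<bar> \<le> K"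
proof -
  have "compact (g ` S)" using image_compactin[OF assms] by simp
  then show ?thesis by (auto dest!: compact_imp_bounded simp: bounded_iff)
qed

text \<open>The positive continuous function \<open>height n f\<close> attains a positive minimum on
  the compact support, while the components and the last coordinate are bounded there. These are the
  qualitative hypotheses of the half-line inequality, available on every line at once.\<close>

lemma C1c_epigraph_field_bounds:
  assumes lip: "\<And>x y. x \<in> Rn n \<Longrightarrow> y \<in> Rn n \<Longrightarrow> \<bar>f x - f y\<bar> \<le> (\<Sum>i<n. \<bar>x i - y i\<bar>)"
    and u: "u \<in> C1c_fields (Suc n) (epigraph_domain (Suc n) f)"
  defines "w \<equiv> zero_extension (Suc n) (epigraph_domain (Suc n) f) u"
  shows "\<exists>\<delta>>0. \<exists>R K. \<forall>x\<in>Rn (Suc n). (\<forall>j<Suc n. \<bar>w x j\<bar> \<le> K) \<and>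
     (w x \<noteq> Rn_zero (Suc n) \<longrightarrow> \<delta> \<le> height n f x \<and> x n \<le> R)"
proof -
  let ?d = "Suc n" and ?D = "epigraph_domain (Suc n) f"
  define S where "S = field_support ?d ?D u"
  have D: "openin (Rn_top ?d) ?D" by (rule openin_epigraph_domain[OF lip])
  have w: "w \<in> C1c_fields ?d (Rn ?d)" unfolding w_def by (rule zero_extension_C1c[OF D u])
  have S: "compactin (Rn_top ?d) S" "S \<subseteq> ?D" using u by (auto simp: C1c_fields_def S_def)
  have wS: "x \<in> S" if "x \<in> Rn ?d" "w x \<noteq> Rn_zero ?d" for x
    using that field_nonzero_in_support[OF openin_Rn_top_imp_subset[OF D], of x u]
    by (auto simp: w_def zero_extension_def S_def split: if_splits)
  have "\<exists>\<delta>>0. \<forall>x\<in>S. \<delta> \<le> height n f x"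
  proof (cases "S = {}")
    case True then show ?thesis by (auto intro: exI[of _ 1])
  next
    case False
    have "continuous_map (Rn_top ?d) euclideanreal (height n f)"
      by (rule continuous_map_height[OF lip])
    from image_compactin[OF S(1) this] have "compact (height n f ` S)"
      unfolding compactin_euclidean_iff .
    moreover have "height n f ` S \<noteq> {}" using False by blast
    ultimately obtain m where m: "m \<in> height n f ` S" "\<forall>t\<in>height n f ` S. m \<le> t"
      using compact_attains_inf by metis
    then have "0 < m" using S(2) unfolding epigraph_domain_Suc by blast
    then show ?thesis using m(2) by blast
  qed
  then obtain \<delta> where \<delta>: "\<delta> > 0" "\<And>x. x \<in> S \<Longrightarrow> \<delta> \<le> height n f x" by blast
  have "continuous_map (Rn_top ?d) euclideanreal (\<lambda>x. x n)"
    unfolding Rn_top_def by (rule continuous_map_product_projection) auto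
  then obtain R where R: "\<And>x. x \<in> S \<Longrightarrow> \<bar>x n\<bar> \<le> R" using compactin_Rn_bounded_image[OF S(1)] by blast
  have "\<exists>K. \<forall>x\<in>S. \<bar>w x j\<bar> \<le> K" if "j < ?d" for j
    by (rule compactin_Rn_bounded_image[OF S(1) C1c_fields_continuous[OF w that]])
  then have "\<forall>j. \<exists>K. j < ?d \<longrightarrow> (\<forall>x\<in>S. \<bar>w x j\<bar> \<le> K)" by blast
  then obtain K where K: "\<And>j x. j < ?d \<Longrightarrow> x \<in> S \<Longrightarrow> \<bar>w x j\<bar> \<le> K j" unfolding choice_iff by blast
  \<comment> \<open>The 0 makes the bound valid also where the field vanishes.\<close>
  define K0 where "K0 = Max (insert 0 (K ` {..<?d}))"
  have K0: "0 \<le> K0" "\<And>j. j < ?d \<Longrightarrow> K j \<le> K0" unfolding K0_def by (intro Max_ge; simp)+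
  have "(\<forall>j<?d. \<bar>w x j\<bar> \<le> K0) \<and> (w x \<noteq> Rn_zero ?d \<longrightarrow> \<delta> \<le> height n f x \<and> x n \<le> R)" if x: "x \<in> Rn ?d" for x
  proof (cases "w x = Rn_zero ?d")
    case True
    then show ?thesis using K0(1) by (simp add: Rn_zero_def)
  next
    case False
    have "x \<in> S" using wS[OF x False] .
    then show ?thesis using K K0(2) \<delta>(2) R by (fastforce intro: order_trans)
  qed
  then show ?thesis using \<delta>(1) by blast
qed


section \<open>The Hardy inequality on epigraphs\<close>

text \<open>The integrand of \<open>X_seminorm\<close> as a single function of the pair, so that its
  joint measurability can be stated for Fubini.\<close>

definition X_integrand ::
  "nat \<Rightarrow> real \<Rightarrow> real \<Rightarrow> ((nat \<Rightarrow> real) \<Rightarrow> (nat \<Rightarrow> real)) \<Rightarrow> (nat \<Rightarrow> real) \<times> (nat \<Rightarrow> real) \<Rightarrow> real" where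
  "X_integrand d s p u = (\<lambda>(x, y).
     \<bar>Rn_inner d (Rn_minus d (u x) (u y)) (\<lambda>i\<in>{..<d}. (x i - y i) / Rn_dist d x y)\<bar> powr p
          / Rn_dist d x y powr (real d + s * p))"

lemma X_integrand_eq: "X_integrand d s p u (x, y) =
    \<bar>(\<Sum>i<d. (u x i - u y i) * (x i - y i)) / Rn_dist d x y\<bar> powr p / Rn_dist d x y powr (real d + s * p)"
  by (simp add: X_integrand_def Rn_inner_def Rn_minus_def sum_divide_distrib)

lemma X_integrand_nonneg [simp]: "0 \<le> X_integrand d s p u z"
  by (cases z) (simp add: X_integrand_eq)

lemma measurable_Rn_dist [measurable (raw)]:
  assumes [measurable]: "g \<in> measurable N (Rn_lborel d)" "h \<in> measurable N (Rn_lborel d)"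
  shows "(\<lambda>z. Rn_dist d (g z) (h z)) \<in> borel_measurable N"
  supply measurable_Rn_component [measurable (raw)]
  unfolding Rn_dist_eq_L2_set L2_set_def by measurable

lemma measurable_X_integrand [measurable]:
  assumes [measurable]: "u \<in> measurable (Rn_lborel d) (Rn_lborel d)"
  shows "X_integrand d s p u \<in> borel_measurable (Rn_lborel d \<Otimes>\<^sub>M Rn_lborel d)"
proof -
  note measurable_Rn_component [measurable (raw)]
  have "X_integrand d s p u = (\<lambda>z. \<bar>(\<Sum>i<d. (u (fst z) i - u (snd z) i) * (fst z i - snd z i)) / Rn_dist d (fst z) (snd z)\<bar> powr p
      / Rn_dist d (fst z) (snd z) powr (real d + s * p))"
    using X_integrand_eq by (simp add: fun_eq_iff)
  then show ?thesis by simp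
qed

lemma C1c_field_measurable:
  assumes "u \<in> C1c_fields d (Rn d)"
  shows "u \<in> measurable (Rn_lborel d) (Rn_lborel d)"
proof -
  have "(\<lambda>x. \<lambda>i\<in>{..<d}. u x i) \<in> measurable (Rn_lborel d) (Rn_lborel d)"
    using continuous_imp_borel_measurable_Rn[OF C1c_fields_continuous[OF assms]]
    by (rule measurable_Rn_lborel)
  moreover have "u x = (\<lambda>i\<in>{..<d}. u x i)" if "x \<in> space (Rn_lborel d)" for x
  proof -
    have "u x \<in> Rn d" using assms that by (auto simp: C1c_fields_def space_Rn_lborel)
    then show ?thesis unfolding Rn_def by (auto simp: PiE_iff extensional_def fun_eq_iff)
  qed
  ultimately show ?thesis using measurable_cong by (smt (verit))
qed

text \<open>The inner product of \<open>v\<close> with the direction \<open>(a, 1)\<close>, left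
  unnormalised so that it is affine in \<open>a\<close>.\<close>

definition dir_component :: "nat \<Rightarrow> (nat \<Rightarrow> real) \<Rightarrow> (nat \<Rightarrow> real) \<Rightarrow> real" where
  "dir_component n a v = (\<Sum>i<n. v i * a i) + v n"

lemma measurable_dir_component [measurable (raw)]:
  assumes [measurable]: "g \<in> measurable N (Rn_lborel n)" "h \<in> measurable N (Rn_lborel (Suc n))"
  shows "(\<lambda>z. dir_component n (g z) (h z)) \<in> borel_measurable N"
  supply measurable_Rn_component [measurable (raw)]
  unfolding dir_component_def by measurable

text \<open>Two points of the line differ by a multiple of \<open>(a, 1)\<close>, so the projection
  in the integrand is the component in that direction up to normalisation. The kernel exponent
  \<open>Suc n + s * p\<close> splits into the one-dimensional exponent \<open>1 + s * p\<close> and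
  \<open>n\<close> further powers, which the Jacobian weight cancels.\<close>

lemma X_integrand_on_line:
  fixes a x :: "nat \<Rightarrow> real"
  assumes a: "(\<Sum>i<n. \<bar>a i\<bar>) \<le> 1/2" and p: "p > 0" and s: "s > 0"
  defines "P \<equiv> line_point n a x"
  shows "\<bar>dir_component n a (w (P t)) - dir_component n a (w (P t'))\<bar> powr p / \<bar>t - t'\<bar> powr (1 + s * p)
     \<le> 2 powr (p + Suc n + s * p) * (\<bar>t' - t\<bar> ^ n * X_integrand (Suc n) s p w (P t, P t'))"
proof (cases "t = t'")
  case False
  let ?r = "\<bar>t - t'\<bar>"
  define G where "G = dir_component n a (w (P t)) - dir_component n a (w (P t'))"
  \<comment> \<open>The Euclidean length of \<open>(a, 1)\<close>; every power of it is absorbed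
    into the constant through \<open>A \<le> 2\<close>.\<close>
  define A where "A = sqrt ((\<Sum>i<n. (a i)\<^sup>2) + 1)"
  have r: "?r > 0" using False by simp
  have diff: "P t i - P t' i = (t - t') * (if i < n then a i else 1)" if "i < Suc n" for i
    using that by (auto simp: P_def line_point_def algebra_simps)
  have A: "A > 0" "A \<le> 2"
  proof -
    have "(\<Sum>i<n. (a i)\<^sup>2) \<ge> 0" by (simp add: sum_nonneg)
    then show "A > 0" by (simp add: A_def)
    have "\<bar>a i\<bar> \<le> 1/2" if "i < n" for i
      using a member_le_sum[of i "{..<n}" "\<lambda>i. \<bar>a i\<bar>"] that by simp
    then have "(a i)\<^sup>2 \<le> \<bar>a i\<bar>" if "i < n" for i
      using that mult_right_mono[of "\<bar>a i\<bar>" 1 "\<bar>a i\<bar>"] by (fastforce simp: power2_eq_square abs_mult_self_eq)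
    then have "(\<Sum>i<n. (a i)\<^sup>2) \<le> (\<Sum>i<n. \<bar>a i\<bar>)" by (intro sum_mono) auto
    then show "A \<le> 2" unfolding A_def using a by (intro real_le_lsqrt) auto
  qed
  have dist: "Rn_dist (Suc n) (P t) (P t') = ?r * A"
  proof -
    have "(\<Sum>i<Suc n. (P t i - P t' i)\<^sup>2) = (\<Sum>i<Suc n. (t - t')\<^sup>2 * (if i < n then (a i)\<^sup>2 else 1))"
      by (intro sum.cong) (auto simp: diff power_mult_distrib)
    also have "\<dots> = (t - t')\<^sup>2 * ((\<Sum>i<n. (a i)\<^sup>2) + 1)"
      by (simp add: sum_distrib_left distrib_left)
    finally show ?thesis unfolding Rn_dist_eq_L2_set L2_set_def A_def by (simp add: real_sqrt_mult)
  qed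
  have inner: "(\<Sum>i<Suc n. (w (P t) i - w (P t') i) * (P t i - P t' i)) = (t - t') * G"
  proof -
    have "(\<Sum>i<Suc n. (w (P t) i - w (P t') i) * (P t i - P t' i)) =
       (\<Sum>i<Suc n. (t - t') * ((w (P t) i - w (P t') i) * (if i < n then a i else 1)))"
      by (intro sum.cong) (auto simp: diff)
    also have "\<dots> = (t - t') * G"
      unfolding sum_distrib_left[symmetric]
      by (simp add: G_def dir_component_def sum_subtractf left_diff_distrib)
    finally show ?thesis .
  qed
  have "X_integrand (Suc n) s p w (P t, P t') = (\<bar>G\<bar> / A) powr p / (?r * A) powr (Suc n + s * p)"
    unfolding X_integrand_eq inner dist using r A(1) by (simp add: abs_mult abs_divide)
  also have "\<dots> = \<bar>G\<bar> powr p / (?r ^ n * ?r powr (1 + s * p) * A powr (p + Suc n + s * p))"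
  proof -
    have "?r powr (Suc n + s * p) = ?r ^ n * ?r powr (1 + s * p)"
      using r by (simp add: powr_add powr_realpow[symmetric])
    moreover have "A powr (p + Suc n + s * p) = A powr p * A powr (Suc n + s * p)"
      by (simp add: powr_add)
    ultimately show ?thesis using r A(1) by (simp add: powr_mult powr_divide)
  qed
  finally have K: "\<bar>G\<bar> powr p / ?r powr (1 + s * p) =
     A powr (p + Suc n + s * p) * (?r ^ n * X_integrand (Suc n) s p w (P t, P t'))"
    using r A(1) by simp
  have "A powr (p + Suc n + s * p) \<le> 2 powr (p + Suc n + s * p)"
    using A p s by (intro powr_mono2) auto
  then show ?thesis
    unfolding G_def[symmetric] K by (simp add: abs_minus_commute mult_right_mono)
qed simp

text \<open>Translating the entry point \<open>h\<close> of the line to 0 reduces to the half-line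
  inequality. The constant is fixed before \<open>n\<close>, \<open>f\<close>, \<open>u\<close>,
  \<open>a\<close> and \<open>x\<close>, as it must be for the later integration over lines and
  directions.\<close>

lemma hardy_on_line:
  fixes p \<sigma> :: real
  assumes p: "1 < p" and \<sigma>: "0 < \<sigma>" "\<sigma> \<noteq> 1"
  shows "\<exists>C>0. \<forall>n f u a x.
    (\<forall>x\<in>Rn n. \<forall>y\<in>Rn n. \<bar>f x - f y\<bar> \<le> (\<Sum>i<n. \<bar>x i - y i\<bar>)) \<and>
    u \<in> C1c_fields (Suc n) (epigraph_domain (Suc n) f) \<and>
    a \<in> Rn n \<and> x \<in> Rn n \<and> (\<Sum>i<n. \<bar>a i\<bar>) \<le> 1/2 \<longrightarrow>
    (let D = epigraph_domain (Suc n) f; w = zero_extension (Suc n) D u; P = line_point n a x;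
         g = (\<lambda>t. dir_component n a (w (P t))) in
     (\<integral>\<^sup>+t. indicator D (P t) * ennreal (\<bar>g t\<bar> powr p / height n f (P t) powr \<sigma>) \<partial>lborel)
     \<le> ennreal C * (\<integral>\<^sup>+t. \<integral>\<^sup>+t'. indicator D (P t) * indicator D (P t') *
          ennreal (\<bar>g t - g t'\<bar> powr p / \<bar>t - t'\<bar> powr (1 + \<sigma>)) \<partial>lborel \<partial>lborel))"
proof -
  from hardy_half_line[OF assms] obtain C where C: "C > 0" and
    H: "\<And>g::real \<Rightarrow> real. g \<in> borel_measurable borel \<Longrightarrow>
     (\<exists>\<delta>>0. \<exists>R K. \<forall>t. \<bar>g t\<bar> \<le> K \<and> (g t \<noteq> 0 \<longrightarrow> \<delta> \<le> t \<and> t \<le> R)) \<Longrightarrow>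
     (\<integral>\<^sup>+t. indicator {0<..} t * ennreal (\<bar>g t\<bar> powr p / t powr \<sigma>) \<partial>lborel) \<le>
     ennreal C * (\<integral>\<^sup>+t. \<integral>\<^sup>+t'. indicator {0<..} t * indicator {0<..} t' *
        ennreal (\<bar>g t - g t'\<bar> powr p / \<bar>t - t'\<bar> powr (1 + \<sigma>)) \<partial>lborel \<partial>lborel)" by blast
  show ?thesis
    unfolding Let_def
  \<comment> \<open>The factor \<open>2 powr \<sigma>\<close> pays for replacing the height by its
    lower bound \<open>(t - h) / 2\<close> in the weight.\<close>
  proof (intro exI[of _ "2 powr \<sigma> * C"] conjI allI impI)
    show "2 powr \<sigma> * C > 0" using C by simp
    fix n :: nat and f u a x
    assume *: "(\<forall>x\<in>Rn n. \<forall>y\<in>Rn n. \<bar>f x - f y\<bar> \<le> (\<Sum>i<n. \<bar>x i - y i\<bar>)) \<and>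
      u \<in> C1c_fields (Suc n) (epigraph_domain (Suc n) f) \<and>
      a \<in> Rn n \<and> x \<in> Rn n \<and> (\<Sum>i<n. \<bar>a i\<bar>) \<le> 1/2"
    define D where "D = epigraph_domain (Suc n) f"
    define w where "w = zero_extension (Suc n) D u"
    define P where "P = line_point n a x"
    define g where "g t = dir_component n a (w (P t))" for t
    have lip: "\<And>x y. x \<in> Rn n \<Longrightarrow> y \<in> Rn n \<Longrightarrow> \<bar>f x - f y\<bar> \<le> (\<Sum>i<n. \<bar>x i - y i\<bar>)"
      and u: "u \<in> C1c_fields (Suc n) D"
      and [measurable]: "a \<in> space (Rn_lborel n)" "x \<in> space (Rn_lborel n)"
      and a: "(\<Sum>i<n. \<bar>a i\<bar>) \<le> 1/2"
      using * by (auto simp: D_def space_Rn_lborel)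
    have D: "openin (Rn_top (Suc n)) D" unfolding D_def by (rule openin_epigraph_domain[OF lip])
    have [measurable]: "w \<in> measurable (Rn_lborel (Suc n)) (Rn_lborel (Suc n))"
      unfolding w_def by (rule C1c_field_measurable[OF zero_extension_C1c[OF D u]])
    have [measurable]: "g \<in> borel_measurable borel" unfolding g_def P_def by measurable
    have PR: "P t \<in> Rn (Suc n)" for t by (simp add: P_def line_point_def Rn_def)
    have height_P: "height n f (P t) = t - f (\<lambda>i\<in>{..<n}. x i + t * a i)" for t
    proof -
      have "restrict (P t) {..<n} = (\<lambda>i\<in>{..<n}. x i + t * a i)"
        by (auto simp: P_def line_point_def fun_eq_iff)
      then show ?thesis by (simp add: height_def P_def line_point_def)
    qed
    from epigraph_on_line[OF lip a, of x] obtain h where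
      h: "\<And>t. height n f (P t) > 0 \<longleftrightarrow> t > h"
         "\<And>t. t > h \<Longrightarrow> height n f (P t) \<ge> (t - h) / 2"
         "\<And>t. t > h \<Longrightarrow> height n f (P t) \<le> 2 * (t - h)"
      unfolding height_P by blast
    have PD: "P t \<in> D \<longleftrightarrow> t > h" for t
      unfolding D_def epigraph_domain_Suc using h(1) PR by simp
    obtain \<delta> R K where \<delta>: "\<delta> > 0" and
      wK: "\<And>y j. y \<in> Rn (Suc n) \<Longrightarrow> j < Suc n \<Longrightarrow> \<bar>w y j\<bar> \<le> K" and
      ws: "\<And>y. y \<in> Rn (Suc n) \<Longrightarrow> w y \<noteq> Rn_zero (Suc n) \<Longrightarrow> \<delta> \<le> height n f y \<and> y n \<le> R"
      using C1c_epigraph_field_bounds[OF lip u[unfolded D_def]] unfolding w_def D_def by blast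
    \<comment> \<open>On the support the height is at least \<delta> and at most
      \<open>2 * t\<close>, which gives \<open>\<delta> / 2\<close>; the end \<open>R - h\<close>
      comes from the last coordinate \<open>h + t\<close> being at most \<open>R\<close>.\<close>
    have core: "\<bar>g (h + t)\<bar> \<le> (\<Sum>i<n. K * \<bar>a i\<bar>) + K \<and> (g (h + t) \<noteq> 0 \<longrightarrow> \<delta> / 2 \<le> t \<and> t \<le> R - h)" for t
    proof (intro conjI impI)
      have "\<bar>g (h + t)\<bar> \<le> \<bar>\<Sum>i<n. w (P (h + t)) i * a i\<bar> + \<bar>w (P (h + t)) n\<bar>"
        unfolding g_def dir_component_def by (rule abs_triangle_ineq)
      also have "\<dots> \<le> (\<Sum>i<n. \<bar>w (P (h + t)) i * a i\<bar>) + \<bar>w (P (h + t)) n\<bar>"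
        by (intro add_right_mono sum_abs)
      also have "\<dots> \<le> (\<Sum>i<n. K * \<bar>a i\<bar>) + K"
        using wK[OF PR] by (intro add_mono sum_mono) (auto simp: abs_mult intro!: mult_right_mono)
      finally show "\<bar>g (h + t)\<bar> \<le> (\<Sum>i<n. K * \<bar>a i\<bar>) + K" .
      assume "g (h + t) \<noteq> 0"
      then have "w (P (h + t)) \<noteq> Rn_zero (Suc n)"
        by (auto simp: g_def dir_component_def Rn_zero_def)
      from ws[OF PR this] have le: "\<delta> \<le> height n f (P (h + t))" "P (h + t) n \<le> R" by auto
      then have "h + t > h" using h(1) \<delta> by (meson less_le_trans)
      then show "\<delta> / 2 \<le> t" using h(3)[of "h + t"] le(1) by simp
      show "t \<le> R - h" using le(2) by (simp add: P_def line_point_def)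
    qed
    have bounds: "\<exists>\<delta>>0. \<exists>R K. \<forall>t. \<bar>g (h + t)\<bar> \<le> K \<and> (g (h + t) \<noteq> 0 \<longrightarrow> \<delta> \<le> t \<and> t \<le> R)"
      using core half_gt_zero[OF \<delta>] by blast
    have [measurable]: "height n f \<in> borel_measurable (Rn_lborel (Suc n))" "D \<in> sets (Rn_lborel (Suc n))"
      by (rule measurable_height[OF lip], assumption+, rule open_in_sets_Rn_lborel[OF D])
    have "(\<integral>\<^sup>+t. indicator D (P t) * ennreal (\<bar>g t\<bar> powr p / height n f (P t) powr \<sigma>) \<partial>lborel)
       \<le> (\<integral>\<^sup>+t. ennreal (2 powr \<sigma>) * (indicator {0<..} (- h + t) * ennreal (\<bar>g t\<bar> powr p / (- h + t) powr \<sigma>)) \<partial>lborel)"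
    proof (rule nn_integral_mono)
      fix t
      show "indicator D (P t) * ennreal (\<bar>g t\<bar> powr p / height n f (P t) powr \<sigma>) \<le>
        ennreal (2 powr \<sigma>) * (indicator {0<..} (- h + t) * ennreal (\<bar>g t\<bar> powr p / (- h + t) powr \<sigma>))"
      proof (cases "t > h")
        case True
        have "((t - h) / 2) powr \<sigma> \<le> height n f (P t) powr \<sigma>"
          using h(2)[OF True] True \<sigma> by (intro powr_mono2) auto
        then have "\<bar>g t\<bar> powr p / height n f (P t) powr \<sigma> \<le> \<bar>g t\<bar> powr p / ((t - h) / 2) powr \<sigma>"
          using True h(1)[of t] by (intro divide_left_mono) auto
        also have "\<dots> = 2 powr \<sigma> * (\<bar>g t\<bar> powr p / (- h + t) powr \<sigma>)"
          using True by (simp add: powr_divide)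
        finally show ?thesis using True PD[of t] by (simp add: ennreal_mult[symmetric] ennreal_leI)
      qed (simp add: PD)
    qed
    also have "\<dots> = ennreal (2 powr \<sigma>) * (\<integral>\<^sup>+t. indicator {0<..} (- h + t) * ennreal (\<bar>g t\<bar> powr p / (- h + t) powr \<sigma>) \<partial>lborel)"
      by (rule nn_integral_cmult) measurable
    also have "(\<integral>\<^sup>+t. indicator {0<..} (- h + t) * ennreal (\<bar>g t\<bar> powr p / (- h + t) powr \<sigma>) \<partial>lborel)
      = (\<integral>\<^sup>+t. indicator {0<..} t * ennreal (\<bar>g (h + t)\<bar> powr p / t powr \<sigma>) \<partial>lborel)"
      by (subst nn_integral_real_affine[where c=1 and t=h]) auto
    also have "\<dots> \<le> ennreal C * (\<integral>\<^sup>+t. \<integral>\<^sup>+t'. indicator {0<..} t * indicator {0<..} t' *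
        ennreal (\<bar>g (h + t) - g (h + t')\<bar> powr p / \<bar>t - t'\<bar> powr (1 + \<sigma>)) \<partial>lborel \<partial>lborel)"
      by (rule H) (use bounds in auto)
    also have "(\<integral>\<^sup>+t. \<integral>\<^sup>+t'. indicator {0<..} t * indicator {0<..} t' *
        ennreal (\<bar>g (h + t) - g (h + t')\<bar> powr p / \<bar>t - t'\<bar> powr (1 + \<sigma>)) \<partial>lborel \<partial>lborel) =
      (\<integral>\<^sup>+t. \<integral>\<^sup>+t'. indicator {0<..} (- h + t) * indicator {0<..} (- h + t') *
        ennreal (\<bar>g t - g t'\<bar> powr p / \<bar>t - t'\<bar> powr (1 + \<sigma>)) \<partial>lborel \<partial>lborel)"
    proof -
      have "(\<integral>\<^sup>+t'. indicator {0<..} t * indicator {0<..} t' *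
        ennreal (\<bar>g (h + t) - g (h + t')\<bar> powr p / \<bar>t - t'\<bar> powr (1 + \<sigma>)) \<partial>lborel) =
        (\<integral>\<^sup>+t'. indicator {0<..} (- h + (h + t)) * indicator {0<..} (- h + t') *
          ennreal (\<bar>g (h + t) - g t'\<bar> powr p / \<bar>(h + t) - t'\<bar> powr (1 + \<sigma>)) \<partial>lborel)" for t
        by (subst (2) nn_integral_real_affine[where c=1 and t=h]) auto
      then show ?thesis
        by (subst (3) nn_integral_real_affine[where c=1 and t=h]) auto
    qed
    also have "\<dots> = (\<integral>\<^sup>+t. \<integral>\<^sup>+t'. indicator D (P t) * indicator D (P t') *
          ennreal (\<bar>g t - g t'\<bar> powr p / \<bar>t - t'\<bar> powr (1 + \<sigma>)) \<partial>lborel \<partial>lborel)"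
      by (intro nn_integral_cong) (auto simp: PD indicator_def)
    finally have "(\<integral>\<^sup>+t. indicator D (P t) * ennreal (\<bar>g t\<bar> powr p / height n f (P t) powr \<sigma>) \<partial>lborel)
      \<le> ennreal (2 powr \<sigma> * C) * (\<integral>\<^sup>+t. \<integral>\<^sup>+t'. indicator D (P t) * indicator D (P t') *
          ennreal (\<bar>g t - g t'\<bar> powr p / \<bar>t - t'\<bar> powr (1 + \<sigma>)) \<partial>lborel \<partial>lborel)"
      using C by (simp add: ennreal_mult mult.assoc mult_left_mono)
    then show "(\<integral>\<^sup>+t. indicator (epigraph_domain (Suc n) f) (line_point n a x t) *
        ennreal (\<bar>dir_component n a (zero_extension (Suc n) (epigraph_domain (Suc n) f) u (line_point n a x t))\<bar> powr p /
          height n f (line_point n a x t) powr \<sigma>) \<partial>lborel)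
      \<le> ennreal (2 powr \<sigma> * C) * (\<integral>\<^sup>+t. \<integral>\<^sup>+t'. indicator (epigraph_domain (Suc n) f) (line_point n a x t) *
          indicator (epigraph_domain (Suc n) f) (line_point n a x t') *
          ennreal (\<bar>dir_component n a (zero_extension (Suc n) (epigraph_domain (Suc n) f) u (line_point n a x t)) -
            dir_component n a (zero_extension (Suc n) (epigraph_domain (Suc n) f) u (line_point n a x t'))\<bar> powr p /
            \<bar>t - t'\<bar> powr (1 + \<sigma>)) \<partial>lborel \<partial>lborel)"
      by (simp only: g_def P_def w_def D_def)
  qed
qed


text \<open>The three constants come from averaging over directions, from the inequality on a line
  and from the kernel comparison. Each is fixed before \<open>f\<close> and \<open>u\<close>, and so
  is their product.\<close>

lemma hardy_epigraph:
  fixes s p :: real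
  assumes n: "n > 0" and p: "1 < p" and s: "0 < s" and sp: "s * p \<noteq> 1"
  shows "\<exists>C>0. \<forall>f u.
    (\<forall>x\<in>Rn n. \<forall>y\<in>Rn n. \<bar>f x - f y\<bar> \<le> (\<Sum>i<n. \<bar>x i - y i\<bar>)) \<and>
    u \<in> C1c_fields (Suc n) (epigraph_domain (Suc n) f) \<longrightarrow>
    (let D = epigraph_domain (Suc n) f; w = zero_extension (Suc n) D u in
     (\<integral>\<^sup>+x. indicator D x * ennreal (Rn_norm (Suc n) (w x) powr p / height n f x powr (s * p)) \<partial>Rn_lborel (Suc n))
     \<le> ennreal C * (\<integral>\<^sup>+x. \<integral>\<^sup>+y. indicator D x * indicator D y * ennreal (X_integrand (Suc n) s p w (x, y))
          \<partial>Rn_lborel (Suc n) \<partial>Rn_lborel (Suc n)))"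
proof -
  have sp0: "s * p > 0" using s p by simp
  \<comment> \<open>With this side length the cube lies in the l1 ball of radius 1/2, as the line
    lemmas demand.\<close>
  define \<epsilon> where "\<epsilon> = 1 / (2 * real n)"
  have \<epsilon>: "\<epsilon> > 0" using n by (simp add: \<epsilon>_def)
  define B where "B = {a::nat \<Rightarrow> real. \<forall>i<n. \<bar>a i\<bar> \<le> \<epsilon>}"
  have B_sum: "(\<Sum>i<n. \<bar>a i\<bar>) \<le> 1/2" if "a \<in> B" for a
  proof -
    have "(\<Sum>i<n. \<bar>a i\<bar>) \<le> (\<Sum>i<n. \<epsilon>)" using that by (intro sum_mono) (auto simp: B_def)
    then show ?thesis using n by (simp add: \<epsilon>_def)
  qed
  obtain C0 where C0: "C0 > 0" and avg: "\<And>v. ennreal (Rn_norm (Suc n) v powr p) \<le>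
      ennreal C0 * (\<integral>\<^sup>+a. indicator B a * ennreal (\<bar>dir_component n a v\<bar> powr p) \<partial>Rn_lborel n)"
    using Rn_norm_powr_le_average[OF \<epsilon>, of p n] p unfolding B_def dir_component_def by auto
  obtain C1 where C1: "C1 > 0" and line: "\<forall>n f u a x.
      (\<forall>x\<in>Rn n. \<forall>y\<in>Rn n. \<bar>f x - f y\<bar> \<le> (\<Sum>i<n. \<bar>x i - y i\<bar>)) \<and>
      u \<in> C1c_fields (Suc n) (epigraph_domain (Suc n) f) \<and>
      a \<in> Rn n \<and> x \<in> Rn n \<and> (\<Sum>i<n. \<bar>a i\<bar>) \<le> 1/2 \<longrightarrow>
      (let D = epigraph_domain (Suc n) f; w = zero_extension (Suc n) D u; P = line_point n a x;
           g = (\<lambda>t. dir_component n a (w (P t))) in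
       (\<integral>\<^sup>+t. indicator D (P t) * ennreal (\<bar>g t\<bar> powr p / height n f (P t) powr (s * p)) \<partial>lborel)
       \<le> ennreal C1 * (\<integral>\<^sup>+t. \<integral>\<^sup>+t'. indicator D (P t) * indicator D (P t') *
            ennreal (\<bar>g t - g t'\<bar> powr p / \<bar>t - t'\<bar> powr (1 + s * p)) \<partial>lborel \<partial>lborel))"
    using hardy_on_line[OF p sp0 sp] by (elim exE conjE) (rule that)
  define C2 where "C2 = 2 powr (p + Suc n + s * p)"
  have C2: "C2 > 0" by (simp add: C2_def)
  show ?thesis
    unfolding Let_def
  proof (intro exI[of _ "C0 * (C1 * C2)"] conjI allI impI)
    show "C0 * (C1 * C2) > 0" using C0 C1 C2 by simp
    fix f u
    assume *: "(\<forall>x\<in>Rn n. \<forall>y\<in>Rn n. \<bar>f x - f y\<bar> \<le> (\<Sum>i<n. \<bar>x i - y i\<bar>)) \<and>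
      u \<in> C1c_fields (Suc n) (epigraph_domain (Suc n) f)"
    define D where "D = epigraph_domain (Suc n) f"
    define w where "w = zero_extension (Suc n) D u"
    define h where "h = height n f"
    have lip: "\<And>x y. x \<in> Rn n \<Longrightarrow> y \<in> Rn n \<Longrightarrow> \<bar>f x - f y\<bar> \<le> (\<Sum>i<n. \<bar>x i - y i\<bar>)"
      and u: "u \<in> C1c_fields (Suc n) D"
      using * by (auto simp: D_def)
    have D: "openin (Rn_top (Suc n)) D" unfolding D_def by (rule openin_epigraph_domain[OF lip])
    have w_meas [measurable]: "w \<in> measurable (Rn_lborel (Suc n)) (Rn_lborel (Suc n))"
      unfolding w_def by (rule C1c_field_measurable[OF zero_extension_C1c[OF D u]])
    have h_meas [measurable]: "h \<in> borel_measurable (Rn_lborel (Suc n))"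
      unfolding h_def by (rule measurable_height[OF lip])
    have D_meas [measurable]: "D \<in> sets (Rn_lborel (Suc n))" by (rule open_in_sets_Rn_lborel[OF D])
    have B_meas [measurable]: "Measurable.pred (Rn_lborel n) (\<lambda>a. a \<in> B)"
      unfolding B_def using measurable_Rn_component [measurable (raw)] by measurable
    let ?d = "Suc n"
    let ?P = "line_point n"
    define \<Phi> where "\<Phi> a x = indicator B a * (indicator D x * ennreal (\<bar>dir_component n a (w x)\<bar> powr p / h x powr (s * p)))" for a x
    define F where "F z = indicator D (fst z) * indicator D (snd z) * ennreal (X_integrand ?d s p w z)" for z
    have F_meas [measurable]: "F \<in> borel_measurable (Rn_lborel ?d \<Otimes>\<^sub>M Rn_lborel ?d)"
      unfolding F_def by measurable
    have \<Phi>_meas [measurable]: "(\<lambda>(a, x). \<Phi> a x) \<in> borel_measurable (Rn_lborel n \<Otimes>\<^sub>M Rn_lborel ?d)"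
      unfolding \<Phi>_def by measurable
    have "(\<integral>\<^sup>+x. indicator D x * ennreal (Rn_norm ?d (w x) powr p / h x powr (s * p)) \<partial>Rn_lborel ?d)
      \<le> (\<integral>\<^sup>+x. ennreal C0 * (\<integral>\<^sup>+a. \<Phi> a x \<partial>Rn_lborel n) \<partial>Rn_lborel ?d)"
    proof (rule nn_integral_mono)
      fix x assume [measurable]: "x \<in> space (Rn_lborel ?d)"
      \<comment> \<open>The weight depends on \<open>x\<close> alone, so it can be carried inside
        the average over directions.\<close>
      let ?c = "indicator D x * ennreal (1 / h x powr (s * p))"
      have "indicator D x * ennreal (Rn_norm ?d (w x) powr p / h x powr (s * p)) =
          ?c * ennreal (Rn_norm ?d (w x) powr p)"
        by (simp add: mult.assoc ennreal_mult[symmetric])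
      also have "\<dots> \<le> ?c * (ennreal C0 * (\<integral>\<^sup>+a. indicator B a * ennreal (\<bar>dir_component n a (w x)\<bar> powr p) \<partial>Rn_lborel n))"
        by (rule mult_left_mono[OF avg]) simp
      also have "\<dots> = ennreal C0 * (\<integral>\<^sup>+a. ?c * (indicator B a * ennreal (\<bar>dir_component n a (w x)\<bar> powr p)) \<partial>Rn_lborel n)"
        by (subst nn_integral_cmult) (measurable, simp add: ac_simps)
      also have "(\<integral>\<^sup>+a. ?c * (indicator B a * ennreal (\<bar>dir_component n a (w x)\<bar> powr p)) \<partial>Rn_lborel n) = (\<integral>\<^sup>+a. \<Phi> a x \<partial>Rn_lborel n)"
        by (intro nn_integral_cong) (auto simp: \<Phi>_def indicator_def ennreal_mult[symmetric])
      finally show "indicator D x * ennreal (Rn_norm ?d (w x) powr p / h x powr (s * p)) \<le> ennreal C0 * (\<integral>\<^sup>+a. \<Phi> a x \<partial>Rn_lborel n)" .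
    qed
    also have "\<dots> = ennreal C0 * (\<integral>\<^sup>+x. \<integral>\<^sup>+a. \<Phi> a x \<partial>Rn_lborel n \<partial>Rn_lborel ?d)"
      by (rule nn_integral_cmult) measurable
    also have "(\<integral>\<^sup>+x. \<integral>\<^sup>+a. \<Phi> a x \<partial>Rn_lborel n \<partial>Rn_lborel ?d) = (\<integral>\<^sup>+a. \<integral>\<^sup>+x. \<Phi> a x \<partial>Rn_lborel ?d \<partial>Rn_lborel n)"
      by (rule Rn_lborel_pair.Fubini') measurable
    \<comment> \<open>With the direction now outermost and fixed, space is sliced into the parallel
      lines in that direction.\<close>
    also have "\<dots> = (\<integral>\<^sup>+a. \<integral>\<^sup>+x. \<integral>\<^sup>+t. \<Phi> a (?P a x t) \<partial>lborel \<partial>Rn_lborel n \<partial>Rn_lborel n)"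
      by (intro nn_integral_cong nn_integral_Rn_lines) measurable
    also have "\<dots> \<le> (\<integral>\<^sup>+a. \<integral>\<^sup>+x. ennreal (C1 * C2) * (\<integral>\<^sup>+t. \<integral>\<^sup>+t'. ennreal \<bar>t' - t\<bar> ^ n * F (?P a x t, ?P a x t')
        \<partial>lborel \<partial>lborel) \<partial>Rn_lborel n \<partial>Rn_lborel n)"
    proof (intro nn_integral_mono)
      fix a x assume a [measurable]: "a \<in> space (Rn_lborel n)" and x [measurable]: "x \<in> space (Rn_lborel n)"
      let ?g = "\<lambda>t. dir_component n a (w (?P a x t))"
      show "(\<integral>\<^sup>+t. \<Phi> a (?P a x t) \<partial>lborel) \<le>
        ennreal (C1 * C2) * (\<integral>\<^sup>+t. \<integral>\<^sup>+t'. ennreal \<bar>t' - t\<bar> ^ n * F (?P a x t, ?P a x t') \<partial>lborel \<partial>lborel)"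
      proof (cases "a \<in> B")
        case True
        have "(\<integral>\<^sup>+t. \<Phi> a (?P a x t) \<partial>lborel) =
          (\<integral>\<^sup>+t. indicator D (?P a x t) * ennreal (\<bar>?g t\<bar> powr p / h (?P a x t) powr (s * p)) \<partial>lborel)"
          using True by (simp add: \<Phi>_def)
        also have "\<dots> \<le> ennreal C1 * (\<integral>\<^sup>+t. \<integral>\<^sup>+t'. indicator D (?P a x t) * indicator D (?P a x t') *
            ennreal (\<bar>?g t - ?g t'\<bar> powr p / \<bar>t - t'\<bar> powr (1 + s * p)) \<partial>lborel \<partial>lborel)"
          using line[rule_format, of n f u a x] * a x B_sum[OF True]
          unfolding Let_def D_def[symmetric] w_def[symmetric] h_def[symmetric] space_Rn_lborel by blast
        also have "(\<integral>\<^sup>+t. \<integral>\<^sup>+t'. indicator D (?P a x t) * indicator D (?P a x t') *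
            ennreal (\<bar>?g t - ?g t'\<bar> powr p / \<bar>t - t'\<bar> powr (1 + s * p)) \<partial>lborel \<partial>lborel)
          \<le> (\<integral>\<^sup>+t. \<integral>\<^sup>+t'. ennreal C2 * (ennreal \<bar>t' - t\<bar> ^ n * F (?P a x t, ?P a x t')) \<partial>lborel \<partial>lborel)"
        proof (intro nn_integral_mono)
          fix t t'
          have "ennreal (\<bar>?g t - ?g t'\<bar> powr p / \<bar>t - t'\<bar> powr (1 + s * p)) \<le>
            ennreal (C2 * (\<bar>t' - t\<bar> ^ n * X_integrand ?d s p w (?P a x t, ?P a x t')))"
            unfolding C2_def using X_integrand_on_line[OF B_sum[OF True], of p s w x t t'] p s
            by (intro ennreal_leI) simp
          also have "\<dots> = ennreal C2 * (ennreal \<bar>t' - t\<bar> ^ n * ennreal (X_integrand ?d s p w (?P a x t, ?P a x t')))"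
            using C2 by (simp add: ennreal_mult ennreal_power)
          finally show "indicator D (?P a x t) * indicator D (?P a x t') *
              ennreal (\<bar>?g t - ?g t'\<bar> powr p / \<bar>t - t'\<bar> powr (1 + s * p))
            \<le> ennreal C2 * (ennreal \<bar>t' - t\<bar> ^ n * F (?P a x t, ?P a x t'))"
            unfolding F_def by (auto simp: indicator_def)
        qed
        also have "\<dots> = ennreal C2 * (\<integral>\<^sup>+t. \<integral>\<^sup>+t'. ennreal \<bar>t' - t\<bar> ^ n * F (?P a x t, ?P a x t') \<partial>lborel \<partial>lborel)"
          by (simp add: nn_integral_cmult)
        finally show ?thesis using C1 C2 by (simp add: ennreal_mult mult.assoc mult_left_mono)
      qed (simp add: \<Phi>_def)
    qed
    also have "\<dots> = (\<integral>\<^sup>+a. ennreal (C1 * C2) * (\<integral>\<^sup>+x. \<integral>\<^sup>+t. \<integral>\<^sup>+t'. ennreal \<bar>t' - t\<bar> ^ n * F (?P a x t, ?P a x t')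
        \<partial>lborel \<partial>lborel \<partial>Rn_lborel n) \<partial>Rn_lborel n)"
      by (intro nn_integral_cong nn_integral_cmult) measurable
    also have "\<dots> = ennreal (C1 * C2) * (\<integral>\<^sup>+a. \<integral>\<^sup>+x. \<integral>\<^sup>+t. \<integral>\<^sup>+t'. ennreal \<bar>t' - t\<bar> ^ n * F (?P a x t, ?P a x t')
        \<partial>lborel \<partial>lborel \<partial>Rn_lborel n \<partial>Rn_lborel n)"
      by (rule nn_integral_cmult) measurable
    also have "\<dots> \<le> ennreal (C1 * C2) * (\<integral>\<^sup>+x. \<integral>\<^sup>+y. F (x, y) \<partial>Rn_lborel ?d \<partial>Rn_lborel ?d)"
      by (intro mult_left_mono nn_integral_lines_le_double_integral n F_meas) simp
    finally have "(\<integral>\<^sup>+x. indicator D x * ennreal (Rn_norm ?d (w x) powr p / h x powr (s * p)) \<partial>Rn_lborel ?d)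
      \<le> ennreal (C0 * (C1 * C2)) * (\<integral>\<^sup>+x. \<integral>\<^sup>+y. F (x, y) \<partial>Rn_lborel ?d \<partial>Rn_lborel ?d)"
      using C0 C1 C2 by (simp add: ennreal_mult mult.assoc mult_left_mono)
    then show "(\<integral>\<^sup>+x. indicator (epigraph_domain (Suc n) f) x *
        ennreal (Rn_norm (Suc n) (zero_extension (Suc n) (epigraph_domain (Suc n) f) u x) powr p / height n f x powr (s * p)) \<partial>Rn_lborel (Suc n))
      \<le> ennreal (C0 * (C1 * C2)) * (\<integral>\<^sup>+x. \<integral>\<^sup>+y. indicator (epigraph_domain (Suc n) f) x * indicator (epigraph_domain (Suc n) f) y *
          ennreal (X_integrand (Suc n) s p (zero_extension (Suc n) (epigraph_domain (Suc n) f) u) (x, y))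
          \<partial>Rn_lborel (Suc n) \<partial>Rn_lborel (Suc n))"
      by (simp only: F_def D_def w_def h_def fst_conv snd_conv)
  qed
qed

section \<open>Energy of the extension by zero\<close>

lemma X_integrand_commute: "X_integrand d s p u (x, y) = X_integrand d s p u (y, x)"
proof -
  have "(\<Sum>i<d. (u x i - u y i) * (x i - y i)) = (\<Sum>i<d. (u y i - u x i) * (y i - x i))"
    by (intro sum.cong) (auto simp: algebra_simps)
  then show ?thesis unfolding X_integrand_eq Rn_dist_commute[of d x y] by simp
qed

text \<open>By Cauchy-Schwarz the projected difference is at most the length of \<open>u x\<close>.
  What remains is the pure kernel, whose tail integral produces the Hardy weight.\<close>

lemma X_integrand_le_of_zero:
  assumes "u y = Rn_zero d" "p > 0"
  shows "X_integrand d s p u (x, y) \<le> Rn_norm d (u x) powr p * (1 / Rn_dist d x y powr (real d + s * p))"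
proof -
  have "(\<Sum>i<d. (u x i - u y i) * (x i - y i)) = (\<Sum>i<d. u x i * (x i - y i))"
    using assms(1) by (intro sum.cong) (auto simp: Rn_zero_def)
  also have "\<bar>\<dots>\<bar> \<le> (\<Sum>i<d. \<bar>u x i\<bar> * \<bar>x i - y i\<bar>)"
    by (rule order_trans[OF sum_abs]) (simp add: abs_mult)
  also have "\<dots> \<le> Rn_norm d (u x) * Rn_dist d x y"
    unfolding Rn_norm_def Rn_dist_eq_L2_set by (rule L2_set_mult_ineq)
  finally have "\<bar>(\<Sum>i<d. (u x i - u y i) * (x i - y i)) / Rn_dist d x y\<bar> \<le> Rn_norm d (u x)"
    by (cases "Rn_dist d x y = 0") (auto simp: abs_divide divide_le_eq order_less_le)
  then have "\<bar>(\<Sum>i<d. (u x i - u y i) * (x i - y i)) / Rn_dist d x y\<bar> powr p \<le> Rn_norm d (u x) powr p"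
    using assms(2) by (intro powr_mono2) auto
  then show ?thesis unfolding X_integrand_eq by (simp add: divide_right_mono)
qed

text \<open>Split the pairs of points by membership in \<open>D\<close>. Pairs outside
  \<open>D\<close> contribute nothing, and the two mixed parts agree by symmetry. In a mixed part
  the point outside lies at distance at least the height divided by the dimension, so the kernel
  tail turns the part into the left side of the Hardy inequality.\<close>

lemma zero_extension_energy_le:
  fixes s p :: real
  assumes n: "n > 0" and p: "1 < p" and s: "0 < s" and sp: "s * p \<noteq> 1"
  shows "\<exists>C>0. \<forall>f u.
    (\<forall>x\<in>Rn n. \<forall>y\<in>Rn n. \<bar>f x - f y\<bar> \<le> (\<Sum>i<n. \<bar>x i - y i\<bar>)) \<and>
    u \<in> C1c_fields (Suc n) (epigraph_domain (Suc n) f) \<longrightarrow>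
    (let D = epigraph_domain (Suc n) f; w = zero_extension (Suc n) D u in
     (\<integral>\<^sup>+x. \<integral>\<^sup>+y. ennreal (X_integrand (Suc n) s p w (x, y)) \<partial>Rn_lborel (Suc n) \<partial>Rn_lborel (Suc n))
     \<le> ennreal C * (\<integral>\<^sup>+x. \<integral>\<^sup>+y. indicator D x * indicator D y * ennreal (X_integrand (Suc n) s p w (x, y))
          \<partial>Rn_lborel (Suc n) \<partial>Rn_lborel (Suc n)))"
proof -
  let ?d = "Suc n"
  have sp0: "s * p > 0" using s p by simp
  from hardy_epigraph[OF assms] obtain C where C: "C > 0" and
    H: "\<forall>f u. (\<forall>x\<in>Rn n. \<forall>y\<in>Rn n. \<bar>f x - f y\<bar> \<le> (\<Sum>i<n. \<bar>x i - y i\<bar>)) \<and>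
    u \<in> C1c_fields (Suc n) (epigraph_domain (Suc n) f) \<longrightarrow>
    (let D = epigraph_domain (Suc n) f; w = zero_extension (Suc n) D u in
     (\<integral>\<^sup>+x. indicator D x * ennreal (Rn_norm (Suc n) (w x) powr p / height n f x powr (s * p)) \<partial>Rn_lborel (Suc n))
     \<le> ennreal C * (\<integral>\<^sup>+x. \<integral>\<^sup>+y. indicator D x * indicator D y * ennreal (X_integrand (Suc n) s p w (x, y))
          \<partial>Rn_lborel (Suc n) \<partial>Rn_lborel (Suc n)))"
    by (elim exE conjE) (rule that)
  from nn_integral_kernel_tail_le[OF _ sp0, of ?d] obtain T where T: "T > 0" and
    tail: "\<And>x r. r > 0 \<Longrightarrow>
    (\<integral>\<^sup>+y. indicator {y. r \<le> Rn_dist ?d x y} y * ennreal (1 / Rn_dist ?d x y powr (real ?d + s * p)) \<partial>Rn_lborel ?d)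
    \<le> ennreal (T * r powr - (s * p))" by auto
  \<comment> \<open>The tail is evaluated at the radius height divided by \<open>?d\<close>; the
    extra power converts it into a power of the height.\<close>
  define T' where "T' = T * ?d powr (s * p)"
  have T': "T' > 0" using T by (simp add: T'_def)
  show ?thesis
    unfolding Let_def
  proof (intro exI[of _ "1 + 2 * (T' * C)"] conjI allI impI)
    show "1 + 2 * (T' * C) > 0" using T' C by (simp add: add_pos_pos)
    fix f u
    assume *: "(\<forall>x\<in>Rn n. \<forall>y\<in>Rn n. \<bar>f x - f y\<bar> \<le> (\<Sum>i<n. \<bar>x i - y i\<bar>)) \<and>
      u \<in> C1c_fields (Suc n) (epigraph_domain (Suc n) f)"
    define D where "D = epigraph_domain (Suc n) f"
    define w where "w = zero_extension (Suc n) D u"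
    have lip: "\<And>x y. x \<in> Rn n \<Longrightarrow> y \<in> Rn n \<Longrightarrow> \<bar>f x - f y\<bar> \<le> (\<Sum>i<n. \<bar>x i - y i\<bar>)"
      and u: "u \<in> C1c_fields (Suc n) D"
      using * by (auto simp: D_def)
    have D: "openin (Rn_top (Suc n)) D" unfolding D_def by (rule openin_epigraph_domain[OF lip])
    have w_meas [measurable]: "w \<in> measurable (Rn_lborel (Suc n)) (Rn_lborel (Suc n))"
      unfolding w_def by (rule C1c_field_measurable[OF zero_extension_C1c[OF D u]])
    have D_meas [measurable]: "D \<in> sets (Rn_lborel (Suc n))" by (rule open_in_sets_Rn_lborel[OF D])
    define X where "X x y = ennreal (X_integrand ?d s p w (x, y))" for x y
    have X_meas [measurable]: "(\<lambda>(x, y). X x y) \<in> borel_measurable (Rn_lborel ?d \<Otimes>\<^sub>M Rn_lborel ?d)"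
      unfolding X_def by measurable
    have w0: "w x = Rn_zero ?d" if "x \<in> space (Rn_lborel ?d)" "x \<notin> D" for x
      using that by (simp add: w_def zero_extension_def space_Rn_lborel)
    define N where "N = (\<integral>\<^sup>+x. indicator D x * ennreal (Rn_norm ?d (w x) powr p / height n f x powr (s * p)) \<partial>Rn_lborel ?d)"
    define I where "I = (\<integral>\<^sup>+x. \<integral>\<^sup>+y. indicator D x * indicator D y * X x y \<partial>Rn_lborel ?d \<partial>Rn_lborel ?d)"
    define J where "J = (\<integral>\<^sup>+x. \<integral>\<^sup>+y. indicator D x * indicator (- D) y * X x y \<partial>Rn_lborel ?d \<partial>Rn_lborel ?d)"
    have N_le: "N \<le> ennreal C * I"
      using H[rule_format, OF *] by (simp only: Let_def N_def I_def X_def w_def D_def)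
    have "J \<le> (\<integral>\<^sup>+x. ennreal T' * (indicator D x * ennreal (Rn_norm ?d (w x) powr p / height n f x powr (s * p))) \<partial>Rn_lborel ?d)"
      unfolding J_def
    proof (rule nn_integral_mono)
      fix x assume x [measurable]: "x \<in> space (Rn_lborel ?d)"
      show "(\<integral>\<^sup>+y. indicator D x * indicator (- D) y * X x y \<partial>Rn_lborel ?d) \<le>
        ennreal T' * (indicator D x * ennreal (Rn_norm ?d (w x) powr p / height n f x powr (s * p)))"
      proof (cases "x \<in> D")
        case True
        then have hx: "height n f x > 0" by (simp add: D_def epigraph_domain_Suc)
        define r where "r = height n f x / ?d"
        have r: "r > 0" using hx by (simp add: r_def)
        \<comment> \<open>The height is nonpositive outside \<open>D\<close>, so it drops by at
          least its value at \<open>x\<close>; the l1 distance is at most \<open>?d\<close> times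
          the Euclidean one.\<close>
        have far: "r \<le> Rn_dist ?d x y" if "y \<in> space (Rn_lborel ?d)" "y \<notin> D" for y
        proof -
          have "height n f y \<le> 0" using that by (auto simp: D_def epigraph_domain_Suc space_Rn_lborel)
          then have "height n f x \<le> \<bar>height n f x - height n f y\<bar>" by simp
          also have "\<dots> \<le> (\<Sum>i<?d. \<bar>x i - y i\<bar>)" by (rule height_lipschitz[OF lip])
          also have "\<dots> \<le> ?d * Rn_dist ?d x y" by (rule sum_abs_diff_le_Rn_dist)
          finally show ?thesis by (simp add: r_def field_simps)
        qed
        have "(\<integral>\<^sup>+y. indicator D x * indicator (- D) y * X x y \<partial>Rn_lborel ?d) \<le>
          (\<integral>\<^sup>+y. ennreal (Rn_norm ?d (w x) powr p) *
             (indicator {y. r \<le> Rn_dist ?d x y} y * ennreal (1 / Rn_dist ?d x y powr (real ?d + s * p))) \<partial>Rn_lborel ?d)"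
        proof (rule nn_integral_mono)
          fix y assume y: "y \<in> space (Rn_lborel ?d)"
          show "indicator D x * indicator (- D) y * X x y \<le> ennreal (Rn_norm ?d (w x) powr p) *
             (indicator {y. r \<le> Rn_dist ?d x y} y * ennreal (1 / Rn_dist ?d x y powr (real ?d + s * p)))"
          proof (cases "y \<in> D")
            case False
            have "X x y \<le> ennreal (Rn_norm ?d (w x) powr p * (1 / Rn_dist ?d x y powr (real ?d + s * p)))"
              unfolding X_def using X_integrand_le_of_zero[where u=w and y=y, OF w0[OF y False], of p s x] p by (intro ennreal_leI) auto
            then show ?thesis using False True far[OF y False] by (simp add: ennreal_mult[symmetric])
          qed simp
        qed
        also have "\<dots> = ennreal (Rn_norm ?d (w x) powr p) * (\<integral>\<^sup>+y.
             (indicator {y. r \<le> Rn_dist ?d x y} y * ennreal (1 / Rn_dist ?d x y powr (real ?d + s * p))) \<partial>Rn_lborel ?d)"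
          by (rule nn_integral_cmult) measurable
        also have "\<dots> \<le> ennreal (Rn_norm ?d (w x) powr p) * ennreal (T * r powr - (s * p))"
          by (intro mult_left_mono tail r) simp
        also have "\<dots> = ennreal (Rn_norm ?d (w x) powr p * (T * r powr - (s * p)))"
          using T by (simp add: ennreal_mult)
        also have "Rn_norm ?d (w x) powr p * (T * r powr - (s * p)) =
            T' * (Rn_norm ?d (w x) powr p / height n f x powr (s * p))"
          using hx unfolding r_def T'_def by (simp add: powr_minus_divide powr_divide del: of_nat_Suc)
        finally show ?thesis using True T' by (simp add: ennreal_mult[symmetric] less_imp_le)
      qed simp
    qed
    also have "\<dots> = ennreal T' * N"
    proof -
      have [measurable]: "height n f \<in> borel_measurable (Rn_lborel ?d)" by (rule measurable_height[OF lip])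
      have [measurable]: "(\<lambda>x. Rn_norm ?d (w x)) \<in> borel_measurable (Rn_lborel ?d)"
        unfolding Rn_norm_def L2_set_def using measurable_Rn_component [measurable (raw)] by measurable
      show ?thesis unfolding N_def by (rule nn_integral_cmult) measurable
    qed
    also have "\<dots> \<le> ennreal T' * (ennreal C * I)" by (intro mult_left_mono N_le) simp
    finally have J_le: "J \<le> ennreal (T' * C) * I" using T' C by (simp add: ennreal_mult mult.assoc)
    have J_sym: "(\<integral>\<^sup>+x. \<integral>\<^sup>+y. indicator (- D) x * indicator D y * X x y \<partial>Rn_lborel ?d \<partial>Rn_lborel ?d) = J"
    proof -
      have "(\<integral>\<^sup>+x. \<integral>\<^sup>+y. indicator (- D) x * indicator D y * X x y \<partial>Rn_lborel ?d \<partial>Rn_lborel ?d) =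
        (\<integral>\<^sup>+y. \<integral>\<^sup>+x. indicator (- D) x * indicator D y * X x y \<partial>Rn_lborel ?d \<partial>Rn_lborel ?d)"
        by (rule Rn_lborel_pair.Fubini') measurable
      also have "\<dots> = J"
        unfolding J_def X_def by (intro nn_integral_cong) (simp add: X_integrand_commute[of _ _ _ w] mult.commute)
      finally show ?thesis .
    qed
    have "(\<integral>\<^sup>+x. \<integral>\<^sup>+y. X x y \<partial>Rn_lborel ?d \<partial>Rn_lborel ?d) =
      (\<integral>\<^sup>+x. \<integral>\<^sup>+y. indicator D x * indicator D y * X x y + (indicator D x * indicator (- D) y * X x y
         + indicator (- D) x * indicator D y * X x y) \<partial>Rn_lborel ?d \<partial>Rn_lborel ?d)"
    proof (intro nn_integral_cong)
      fix x y assume "x \<in> space (Rn_lborel ?d)" "y \<in> space (Rn_lborel ?d)"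
      then have "X x y = 0" if "x \<notin> D" "y \<notin> D"
        using that w0 by (simp add: X_def X_integrand_eq)
      then show "X x y = indicator D x * indicator D y * X x y + (indicator D x * indicator (- D) y * X x y
         + indicator (- D) x * indicator D y * X x y)"
        by (auto simp: indicator_def)
    qed
    also have "\<dots> = I + (J + J)"
    proof -
      have "(\<integral>\<^sup>+x. \<integral>\<^sup>+y. indicator D x * indicator D y * X x y + (indicator D x * indicator (- D) y * X x y
           + indicator (- D) x * indicator D y * X x y) \<partial>Rn_lborel ?d \<partial>Rn_lborel ?d) =
         (\<integral>\<^sup>+x. (\<integral>\<^sup>+y. indicator D x * indicator D y * X x y \<partial>Rn_lborel ?d) +
           ((\<integral>\<^sup>+y. indicator D x * indicator (- D) y * X x y \<partial>Rn_lborel ?d)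
           + (\<integral>\<^sup>+y. indicator (- D) x * indicator D y * X x y \<partial>Rn_lborel ?d)) \<partial>Rn_lborel ?d)"
        by (intro nn_integral_cong) (simp add: nn_integral_add)
      also have "\<dots> = I + (J + (\<integral>\<^sup>+x. \<integral>\<^sup>+y. indicator (- D) x * indicator D y * X x y \<partial>Rn_lborel ?d \<partial>Rn_lborel ?d))"
        unfolding I_def J_def by (simp add: nn_integral_add)
      finally show ?thesis by (simp only: J_sym)
    qed
    also have "\<dots> \<le> I + (ennreal (T' * C) * I + ennreal (T' * C) * I)"
      by (intro add_left_mono add_mono J_le)
    also have "\<dots> = ennreal (1 + 2 * (T' * C)) * I"
    proof -
      have "ennreal (1 + (T' * C + T' * C)) = 1 + (ennreal (T' * C) + ennreal (T' * C))"
      proof -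
        have "0 \<le> T' * C" using T' C by simp
        then show ?thesis by (simp only: ennreal_plus ennreal_1 add_nonneg_nonneg zero_le_one)
      qed
      then show ?thesis by (simp only: mult_2 distrib_right mult_1_left)
    qed
    finally show "(\<integral>\<^sup>+x. \<integral>\<^sup>+y. ennreal (X_integrand (Suc n) s p (zero_extension (Suc n) (epigraph_domain (Suc n) f) u) (x, y))
         \<partial>Rn_lborel (Suc n) \<partial>Rn_lborel (Suc n))
      \<le> ennreal (1 + 2 * (T' * C)) * (\<integral>\<^sup>+x. \<integral>\<^sup>+y. indicator (epigraph_domain (Suc n) f) x * indicator (epigraph_domain (Suc n) f) y *
          ennreal (X_integrand (Suc n) s p (zero_extension (Suc n) (epigraph_domain (Suc n) f) u) (x, y))
          \<partial>Rn_lborel (Suc n) \<partial>Rn_lborel (Suc n))"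
      by (simp only: I_def X_def D_def w_def)
  qed
qed

section \<open>From energies to norms\<close>

lemma ennreal_root_mono: "p > 0 \<Longrightarrow> a \<le> b \<Longrightarrow> ennreal_root p a \<le> ennreal_root p b"
  by (cases a; cases b) (auto simp: ennreal_root_def top_unique intro!: ennreal_leI powr_mono2)

lemma ennreal_root_cmult:
  assumes "p > 0" "c > 0"
  shows "ennreal_root p (ennreal c * a) = ennreal (c powr (1 / p)) * ennreal_root p a"
proof (cases a)
  case (real r)
  then show ?thesis using assms
    by (simp add: ennreal_root_def ennreal_mult[symmetric] powr_mult)
next
  case top
  then show ?thesis using assms by (simp add: ennreal_root_def ennreal_mult_top)
qed

theorem proposition1p3:
  shows "\<exists>M0::real. M0 > 0 \<and>
    (\<forall>(d::nat) (s::real) (p::real).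
       d \<ge> 2 \<and> 0 < s \<and> s < 1 \<and> 1 < p \<and> s * p \<noteq> 1 \<longrightarrow>
       (\<exists>C::real. C > 0 \<and>
          (\<forall>f :: (nat \<Rightarrow> real) \<Rightarrow> real.
             supporting_function d f \<and> epigraph_lipschitz_const d f < ennreal M0 \<longrightarrow>
             (\<exists>E. extension_operator d (epigraph_domain d f) E \<and>
                (\<forall>u \<in> C1c_fields d (epigraph_domain d f).
                   X_norm d s p (Rn d) (E u)
                   \<le> ennreal C *
                      (X_norm d s p (epigraph_domain d f) u +
                       epigraph_lipschitz_const d f * W_norm d s p (epigraph_domain d f) u))))))"
proof (rule exI[of _ 1], intro conjI allI impI)
  fix d :: nat and s p :: real
  assume A: "d \<ge> 2 \<and> 0 < s \<and> s < 1 \<and> 1 < p \<and> s * p \<noteq> 1"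
  then obtain n where dn: "d = Suc n" and n: "n > 0" by (cases d) auto
  from A have ps: "1 < p" "0 < s" "s * p \<noteq> 1" by auto
  from zero_extension_energy_le[OF n ps] obtain C where C: "C > 0" and
    energy: "\<forall>f u. (\<forall>x\<in>Rn n. \<forall>y\<in>Rn n. \<bar>f x - f y\<bar> \<le> (\<Sum>i<n. \<bar>x i - y i\<bar>)) \<and>
    u \<in> C1c_fields (Suc n) (epigraph_domain (Suc n) f) \<longrightarrow>
    (let D = epigraph_domain (Suc n) f; w = zero_extension (Suc n) D u in
     (\<integral>\<^sup>+x. \<integral>\<^sup>+y. ennreal (X_integrand (Suc n) s p w (x, y)) \<partial>Rn_lborel (Suc n) \<partial>Rn_lborel (Suc n))
     \<le> ennreal C * (\<integral>\<^sup>+x. \<integral>\<^sup>+y. indicator D x * indicator D y * ennreal (X_integrand (Suc n) s p w (x, y))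
          \<partial>Rn_lborel (Suc n) \<partial>Rn_lborel (Suc n)))"
    by (elim exE conjE) (rule that)
  \<comment> \<open>The root turns the energy constant into \<open>C powr (1 / p)\<close> for the
    seminorm, while the \<open>L^p\<close> norm is preserved exactly and needs factor 1.\<close>
  define c where "c = max 1 (C powr (1 / p))"
  have c: "c > 0" by (simp add: c_def)
  show "\<exists>C>0. \<forall>f. supporting_function d f \<and> epigraph_lipschitz_const d f < ennreal 1 \<longrightarrow>
             (\<exists>E. extension_operator d (epigraph_domain d f) E \<and>
                (\<forall>u \<in> C1c_fields d (epigraph_domain d f).
                   X_norm d s p (Rn d) (E u)
                   \<le> ennreal C *
                      (X_norm d s p (epigraph_domain d f) u +
                       epigraph_lipschitz_const d f * W_norm d s p (epigraph_domain d f) u)))"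
  proof (rule exI[of _ c], intro conjI c allI impI)
    fix f assume f: "supporting_function d f \<and> epigraph_lipschitz_const d f < ennreal 1"
    define D where "D = epigraph_domain d f"
    have lip: "\<And>x y. x \<in> Rn n \<Longrightarrow> y \<in> Rn n \<Longrightarrow> \<bar>f x - f y\<bar> \<le> (\<Sum>i<n. \<bar>x i - y i\<bar>)"
      using supporting_function_lipschitz f unfolding dn by simp
    have D: "openin (Rn_top d) D" unfolding D_def dn by (rule openin_epigraph_domain[OF lip])
    have sub: "D \<subseteq> Rn d" by (rule openin_Rn_top_imp_subset[OF D])
    have "X_norm d s p (Rn d) (zero_extension d D u) \<le>
        ennreal c * (X_norm d s p D u + epigraph_lipschitz_const d f * W_norm d s p D u)"
      if u: "u \<in> C1c_fields d D" for u
    proof -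
      define w where "w = zero_extension d D u"
      have wD: "w x = u x" if "x \<in> D" for x using that sub by (auto simp: w_def zero_extension_def)
      have w0: "w x = Rn_zero d" if "x \<in> Rn d" "x \<notin> D" for x using that by (simp add: w_def zero_extension_def)
      have X_whole: "X_seminorm d s p (Rn d) w = ennreal_root p
          (\<integral>\<^sup>+x. \<integral>\<^sup>+y. ennreal (X_integrand d s p w (x, y)) \<partial>Rn_lborel d \<partial>Rn_lborel d)"
        unfolding X_seminorm_def
        by (intro arg_cong[where f="ennreal_root p"] nn_integral_cong)
           (auto simp: space_Rn_lborel X_integrand_def intro!: nn_integral_cong)
      have X_D: "X_seminorm d s p D u = ennreal_root p
          (\<integral>\<^sup>+x. \<integral>\<^sup>+y. indicator D x * indicator D y * ennreal (X_integrand d s p w (x, y)) \<partial>Rn_lborel d \<partial>Rn_lborel d)"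
        unfolding X_seminorm_def
      proof (intro arg_cong[where f="ennreal_root p"] nn_integral_cong)
        fix x
        let ?k = "\<lambda>y. ennreal (\<bar>Rn_inner d (Rn_minus d (u x) (u y)) (\<lambda>i\<in>{..<d}. (x i - y i) / Rn_dist d x y)\<bar> powr p
          / Rn_dist d x y powr (real d + s * p))"
        show "(\<integral>\<^sup>+y\<in>D. ?k y \<partial>Rn_lborel d) * indicator D x =
          (\<integral>\<^sup>+y. indicator D x * indicator D y * ennreal (X_integrand d s p w (x, y)) \<partial>Rn_lborel d)"
        proof (cases "x \<in> D")
          case True
          then show ?thesis
            by (auto intro!: nn_integral_cong simp: indicator_def X_integrand_def wD)
        qed simp
      qed
      have "X_seminorm d s p (Rn d) w \<le> ennreal_root p (ennreal C *
          (\<integral>\<^sup>+x. \<integral>\<^sup>+y. indicator D x * indicator D y * ennreal (X_integrand d s p w (x, y)) \<partial>Rn_lborel d \<partial>Rn_lborel d))"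
        unfolding X_whole using energy[rule_format, of f u] lip u A
        by (intro ennreal_root_mono) (auto simp: Let_def w_def D_def dn)
      also have "\<dots> = ennreal (C powr (1 / p)) * X_seminorm d s p D u"
        unfolding X_D using C A by (intro ennreal_root_cmult) auto
      also have "\<dots> \<le> ennreal c * X_seminorm d s p D u"
        by (intro mult_right_mono ennreal_leI) (auto simp: c_def)
      finally have X_le: "X_seminorm d s p (Rn d) w \<le> ennreal c * X_seminorm d s p D u" .
      have "Lp_norm d p (Rn d) w = Lp_norm d p D u"
        unfolding Lp_norm_def
      proof (intro arg_cong[where f="ennreal_root p"] nn_integral_cong)
        fix x assume "x \<in> space (Rn_lborel d)"
        then show "ennreal (Rn_norm d (w x) powr p) * indicator (Rn d) x = ennreal (Rn_norm d (u x) powr p) * indicator D x"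
          using wD w0[of x] by (auto simp: space_Rn_lborel indicator_def Rn_norm_def L2_set_def Rn_zero_def)
      qed
      also have "\<dots> \<le> ennreal c * Lp_norm d p D u"
        using mult_right_mono[of 1 "ennreal c" "Lp_norm d p D u"] by (simp add: c_def ennreal_ge_1)
      finally have "X_norm d s p (Rn d) w \<le> ennreal c * X_norm d s p D u"
        using X_le unfolding X_norm_def by (simp add: distrib_left add_mono)
      also have "\<dots> \<le> ennreal c * (X_norm d s p D u + epigraph_lipschitz_const d f * W_norm d s p D u)"
        by (intro mult_left_mono) auto
      finally show ?thesis by (simp add: w_def)
    qed
    then show "\<exists>E. extension_operator d (epigraph_domain d f) E \<and>
                (\<forall>u \<in> C1c_fields d (epigraph_domain d f).
                   X_norm d s p (Rn d) (E u)
                   \<le> ennreal c *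
                      (X_norm d s p (epigraph_domain d f) u +
                       epigraph_lipschitz_const d f * W_norm d s p (epigraph_domain d f) u))"
      using extension_operator_zero_extension[OF D] unfolding D_def by blast
  qed
qed simp

end
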